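(* Let $\rho(\Sigma)$ be the joint spectral radius of a finite set $\Sigma=\{A_1,\dots,A_M\}\subset\mathbb{R}^{n\times n}$ of matrices of dimension $n\in\mathbb{N}$. For any real $\tau>1$ for which there exists $k_\tau\in\mathbb{N}$ satisfying $$\left(\tau-\sqrt{\tau^2-1}\right)^{k_\tau}+\left(\tau+\sqrt{\tau^2-1}\right)^{k_\tau}\;\ge\;6\,D(n,k_\tau)^{1/2},$$ there exists a continuous piecewise linear (CPWL) function represented by a ReLU neural network of depth $$\lceil\log_2(n+1)\rceil+1$$ and width $$\mathcal{O}\left(\left[\binom{D_n^\tau-\lfloor\frac{n+1}{2}\rfloor}{D_n^\tau-n}+\binom{D_n^\tau-\lfloor\frac{n+2}{2}\rfloor}{D_n^\tau-n}\right]^{2n^2+3n+1}\right),$$ where $D_n^\tau:=8\,D(n,k_\tau)$, which approximates $\rho(\Sigma)$ with a precision of $\tau$.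
   Context: For positive integers $n,k$, $D(n,k):=\sum_{m=0}^{\lfloor k/2\rfloor}\binom{n+k-1-2m}{k-2m}$. Joint spectral radius: for a finite set $\Sigma\subset\mathbb{R}^{n\times n}$, $\rho(\Sigma):=\limsup_{k\to\infty}\max\{\|A\|^{1/k}:A\in\Sigma^k\}$, where $\Sigma^k$ is the set of all products of length $k$ of matrices from $\Sigma$ (repetitions allowed) and $\|\cdot\|$ is any matrix norm. Approximation with precision $\tau$: a norm $V$ on $\mathbb{R}^n$ provides the upper approximation $\rho(\Sigma,V):=\max_{A\in\Sigma}\sup_{x\ne 0}V(Ax)/V(x)$ of $\rho(\Sigma)$, i.e. the maximum over $A\in\Sigma$ of the matrix norm of $A$ induced by $V$. The function $V$ approximates $\rho(\Sigma)$ with a precision of $\tau$ if $\frac{1}{\tau}\,\rho(\Sigma,V)\le\rho(\Sigma)\le\rho(\Sigma,V)$. CPWL function: a continuous function $f:\mathbb{R}^n\to\mathbb{R}$ for which there is a finite set of polyhedra whose union is $\mathbb{R}^n$ such that $f$ is linear over each polyhedron. ReLU neural network: a ReLU feedforward neural network with $k$ hidden layers is defined by $k$ affine transformations $T^{(j)}:\mathbb{R}^{n_{j-1}}\to\mathbb{R}^{n_j}$, $x\mapsto W^{(j)}x+b^{(j)}$, $j=1,\dots,k$, and a linear transformation $T^{(k+1)}:\mathbb{R}^{n_k}\to\mathbb{R}^{n_{k+1}}$, $x\mapsto W^{(k+1)}x$. It represents the function $V:\mathbb{R}^{n_0}\to\mathbb{R}^{n_{k+1}}$ given by $V=T^{(k+1)}\circ\sigma\circ\cdots\circ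 T^{(2)}\circ\sigma\circ T^{(1)}$, where $\sigma$ is the componentwise rectifier $x\mapsto(\max\{0,x_1\},\max\{0,x_2\},\dots)$. Here $n_0=n$ and $n_{k+1}=1$. The width of the network is the maximum width $n_j$ of its hidden layers ($1\le j\le k$), and its depth is $k+1$.
   Formalization: The formal theorem additionally assumes ρ(Σ) > 0 or Σ = {0}; if ρ(Σ) = 0 and Σ contains a nonzero matrix (e.g. a single nilpotent one), no norm approximates ρ(Σ) with any finite precision τ, so the claim fails there. *)

theory Defs
  imports
    "HOL-Analysis.Function_Topology"
    "HOL-Library.Extended_Real"
    "HOL-Library.Liminf_Limsup"
    "Jordan_Normal_Form.Matrix"
begin

text \<open>
  The dimension is a natural number (not a type), since the statement quantifies over it below an
  existential quantifier. Vectors and matrices are those with explicit carriers.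
\<close>

definition norm_on_vec :: "nat \<Rightarrow> (real vec \<Rightarrow> real) \<Rightarrow> bool" where
  "norm_on_vec n V \<longleftrightarrow>
     (\<forall>x \<in> carrier_vec n. 0 \<le> V x \<and> (V x = 0 \<longleftrightarrow> x = 0\<^sub>v n)) \<and>
     (\<forall>x \<in> carrier_vec n. \<forall>c. V (c \<cdot>\<^sub>v x) = \<bar>c\<bar> * V x) \<and>
     (\<forall>x \<in> carrier_vec n. \<forall>y \<in> carrier_vec n. V (x + y) \<le> V x + V y)"

text \<open>
  Submultiplicativity is not required: all norms on a space of matrices are equivalent, hence yield
  the same joint spectral radius.
\<close>

definition norm_on_mat :: "nat \<Rightarrow> (real mat \<Rightarrow> real) \<Rightarrow> bool" where
  "norm_on_mat n N \<longleftrightarrow>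
     (\<forall>A \<in> carrier_mat n n. 0 \<le> N A \<and> (N A = 0 \<longleftrightarrow> A = 0\<^sub>m n n)) \<and>
     (\<forall>A \<in> carrier_mat n n. \<forall>c. N (c \<cdot>\<^sub>m A) = \<bar>c\<bar> * N A) \<and>
     (\<forall>A \<in> carrier_mat n n. \<forall>B \<in> carrier_mat n n. N (A + B) \<le> N A + N B)"

definition mat_products :: "nat \<Rightarrow> real mat set \<Rightarrow> nat \<Rightarrow> real mat set" where
  "mat_products n \<Sigma> k = {foldr (*) As (1\<^sub>m n) | As. length As = k \<and> set As \<subseteq> \<Sigma>}"

text \<open>
  The limsup and the supremum below are taken in the extended reals, so that neither involves an
  unspecified value; for norms and finite nonempty sets of matrices both are finite.
\<close>

definition joint_spectral_radius ::
    "nat \<Rightarrow> (real mat \<Rightarrow> real) \<Rightarrow> real mat set \<Rightarrow> ereal" where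
  "joint_spectral_radius n N \<Sigma> =
     limsup (\<lambda>k. ereal (Max ((\<lambda>A. root k (N A)) ` mat_products n \<Sigma> k)))"

definition jsr_upper_approx :: "nat \<Rightarrow> real mat set \<Rightarrow> (real vec \<Rightarrow> real) \<Rightarrow> ereal" where
  "jsr_upper_approx n \<Sigma> V =
     Max ((\<lambda>A. SUP x \<in> carrier_vec n - {0\<^sub>v n}. ereal (V (A *\<^sub>v x) / V x)) ` \<Sigma>)"

text \<open>
  The precision is multiplicative: if the joint spectral radius is \<open>0\<close> but \<open>\<Sigma>\<close> contains a nonzero
  matrix (e.g. a single nilpotent one), then no norm satisfies this for any \<open>\<tau> > 0\<close>.
\<close>

definition approximates_jsr ::
    "nat \<Rightarrow> (real mat \<Rightarrow> real) \<Rightarrow> real mat set \<Rightarrow> real \<Rightarrow> (real vec \<Rightarrow> real) \<Rightarrow> bool" where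
  "approximates_jsr n N \<Sigma> \<tau> V \<longleftrightarrow>
     norm_on_vec n V \<and>
     ereal (1 / \<tau>) * jsr_upper_approx n \<Sigma> V \<le> joint_spectral_radius n N \<Sigma> \<and>
     joint_spectral_radius n N \<Sigma> \<le> jsr_upper_approx n \<Sigma> V"

definition polyhedron_vec :: "nat \<Rightarrow> real vec set \<Rightarrow> bool" where
  "polyhedron_vec n P \<longleftrightarrow>
     (\<exists>H. finite H \<and> H \<subseteq> carrier_vec n \<times> (UNIV :: real set) \<and>
          P = {x \<in> carrier_vec n. \<forall>(a, b) \<in> H. a \<bullet> x \<le> b})"

text \<open>
  Continuity refers to the product topology on the coordinates. The pieces are linear forms
  without constant term.
\<close>

definition cpwl :: "nat \<Rightarrow> (real vec \<Rightarrow> real) \<Rightarrow> bool" where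
  "cpwl n f \<longleftrightarrow>
     continuous_map (product_topology (\<lambda>_. euclideanreal) {..<n}) euclideanreal (\<lambda>x. f (vec n x)) \<and>
     (\<exists>\<P>. finite \<P> \<and> (\<forall>P \<in> \<P>. polyhedron_vec n P) \<and> \<Union>\<P> = carrier_vec n \<and>
          (\<forall>P \<in> \<P>. \<exists>a \<in> carrier_vec n. \<forall>x \<in> P. f x = a \<bullet> x))"

text \<open>
  A network is the list of its hidden layers \<open>(W, b)\<close>, the layer next to the input first, together
  with the matrix of the output transformation.
\<close>

type_synonym relu_net = "(real mat \<times> real vec) list \<times> real mat"

definition relu_vec :: "real vec \<Rightarrow> real vec" where
  "relu_vec = map_vec (max 0)"

fun hidden_layers_eval :: "(real mat \<times> real vec) list \<Rightarrow> real vec \<Rightarrow> real vec" where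
  "hidden_layers_eval [] x = x"
| "hidden_layers_eval ((W, b) # Ls) x = hidden_layers_eval Ls (relu_vec (W *\<^sub>v x + b))"

definition relu_net_eval :: "relu_net \<Rightarrow> real vec \<Rightarrow> real vec" where
  "relu_net_eval net x = snd net *\<^sub>v hidden_layers_eval (fst net) x"

fun compatible_layers :: "nat \<Rightarrow> (real mat \<times> real vec) list \<Rightarrow> real mat \<Rightarrow> nat \<Rightarrow> bool" where
  "compatible_layers n [] U m \<longleftrightarrow> U \<in> carrier_mat m n"
| "compatible_layers n ((W, b) # Ls) U m \<longleftrightarrow>
     W \<in> carrier_mat (dim_row W) n \<and> b \<in> carrier_vec (dim_row W) \<and>
     compatible_layers (dim_row W) Ls U m"

definition relu_net :: "nat \<Rightarrow> nat \<Rightarrow> relu_net \<Rightarrow> bool" where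
  "relu_net n m net \<longleftrightarrow> compatible_layers n (fst net) (snd net) m"

definition relu_net_depth :: "relu_net \<Rightarrow> nat" where
  "relu_net_depth net = length (fst net) + 1"

definition relu_net_width :: "relu_net \<Rightarrow> nat" where
  "relu_net_width net = Max ((\<lambda>(W, b). dim_row W) ` set (fst net))"

definition represents :: "nat \<Rightarrow> relu_net \<Rightarrow> (real vec \<Rightarrow> real) \<Rightarrow> bool" where
  "represents n net V \<longleftrightarrow>
     relu_net n 1 net \<and> (\<forall>x \<in> carrier_vec n. relu_net_eval net x = vec 1 (\<lambda>_. V x))"

text \<open>
  For \<open>k \<ge> 1\<close> no natural subtraction below truncates; note \<open>n \<le> D_num n k\<close>.
\<close>

definition D_num :: "nat \<Rightarrow> nat \<Rightarrow> nat" where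
  "D_num n k = (\<Sum>m = 0..k div 2. (n + k - 1 - 2 * m) choose (k - 2 * m))"

definition vertex_bound :: "nat \<Rightarrow> nat \<Rightarrow> nat" where
  "vertex_bound n k = 8 * D_num n k"

text \<open>The number of facets of a cyclic \<open>n\<close>-polytope with \<open>N\<close> vertices.\<close>

definition facet_bound :: "nat \<Rightarrow> nat \<Rightarrow> nat" where
  "facet_bound n N =
     ((N - (n + 1) div 2) choose (N - n)) + ((N - (n + 2) div 2) choose (N - n))"

end

theory Submission
  imports Defs "Jordan_Normal_Form.Determinant"
begin

text \<open>
  Let \<open>r\<close> be slightly larger than \<open>\<rho>(\<Sigma>)\<close> and let \<open>K\<close> be the set of all rows of \<open>B / r\<^sup>k\<close>,
  where \<open>B\<close> is a product of length \<open>k\<close>. Then \<open>K\<close> is bounded, contains the unit vectors, and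
  right multiplication by \<open>A \<in> \<Sigma>\<close> maps \<open>K\<close> into \<open>r K\<close>, so \<open>x \<mapsto> sup {\<bar>f \<bullet> x\<bar> | f \<in> K}\<close> is a norm in
  which every \<open>A \<in> \<Sigma>\<close> has norm at most \<open>r\<close>. A grid on the coefficients with respect to an
  approximate Auerbach basis of \<open>K\<close> yields a finite \<open>S \<subseteq> K\<close> that determines this norm up to a
  factor close to \<open>1\<close>; since the hypothesis forces \<open>\<tau> - 1\<close> to be at least \<open>1 / (4 k\<^sup>2)\<close>,
  polynomially many (in \<open>k\<close>) cells per axis are enough. The maximum of the linear forms in
  \<open>S \<union> - S\<close> is a linear combination of maxima of at most \<open>n + 1\<close> of them (Wang and Sun), each of
  which is evaluated by a binary tournament of depth \<open>\<lceil>log 2 (n + 1)\<rceil>\<close>.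
\<close>

subsection \<open>Decomposition of maxima of linear forms\<close>


text \<open>The budget to meet is \<open>F ^ ((2 * n + 1) * (n + 1))\<close>, where \<open>F\<close>
  is the facet bound. The factor \<open>n + 1\<close> is the size of the small maxima. The factor
  \<open>2 * n + 1\<close> pays for the number of forms, about \<open>q ^ n\<close> for
  \<open>q\<close> cells per axis: \<open>q\<close> is quadratic in \<open>k\<close>, because
  \<open>\<tau> - 1\<close> may be as small as the order of \<open>1 / k\<^sup>2\<close>, but
  \<open>F\<close> grows at least linearly in \<open>k\<close> once \<open>n \<ge> 2\<close>, so
  \<open>q \<le> F\<^sup>2\<close>. Dimension 1 is exceptional, as \<open>F = 2\<close> there for
  every \<open>k\<close>; two opposite forms then have to do. Two losses are unavoidable in this
  approach: \<open>K\<close> may be unbounded for \<open>r\<close> equal to the joint spectral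
  radius, and a finite \<open>S\<close> determines the norm only up to a factor
  \<open>\<kappa> < 1\<close>. Since \<open>\<tau> > 1\<close> there is room for both, and
  \<open>r\<close> is chosen so that together they cost exactly \<open>\<tau>\<close>.\<close>

lemma homogeneous_system_nontrivial_solution:
  fixes a :: "nat \<Rightarrow> 'a \<Rightarrow> real"
  assumes "finite J" "m < card J"
  shows "\<exists>l. (\<exists>j\<in>J. l j \<noteq> 0) \<and> (\<forall>i<m. (\<Sum>j\<in>J. a i j * l j) = 0)"
  using assms
proof (induction m arbitrary: J a)
  case 0
  then have "J \<noteq> {}" by auto
  then show ?case by (intro exI[of _ "\<lambda>_. 1"]) auto
next
  case (Suc m)
  show ?case
  proof (cases "\<forall>j\<in>J. a m j = 0")
    case True
    obtain l where "\<exists>j\<in>J. l j \<noteq> 0" "\<forall>i<m. (\<Sum>j\<in>J. a i j * l j) = 0"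
      using Suc.IH[of J a] Suc.prems by auto
    then show ?thesis using True by (intro exI[of _ l]) (auto simp: less_Suc_eq)
  next
    case False
    then obtain p where p: "p \<in> J" "a m p \<noteq> 0" by auto
    define J' where "J' = J - {p}"
    have J': "finite J'" "m < card J'" "p \<notin> J'" "J = insert p J'"
      using Suc.prems p by (auto simp: J'_def)
    \<comment> \<open>Gaussian elimination: equation \<open>m\<close>, with pivot
      \<open>a m p\<close>, removes the unknown \<open>p\<close> from the other equations;
      \<open>l'\<close> below is the back substitution.\<close>
    define b where "b i j = a i j - a i p * a m j / a m p" for i j
    obtain l where l: "\<exists>j\<in>J'. l j \<noteq> 0" "\<forall>i<m. (\<Sum>j\<in>J'. b i j * l j) = 0"
      using Suc.IH[of J' b] J' by auto
    define s where "s = (\<Sum>j\<in>J'. a m j * l j)"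
    define l' where "l' = l(p := - s / a m p)"
    have l'J: "(\<Sum>j\<in>J. a i j * l' j) = (\<Sum>j\<in>J'. a i j * l j) - a i p * s / a m p" for i
    proof -
      have "(\<Sum>j\<in>J'. a i j * l' j) = (\<Sum>j\<in>J'. a i j * l j)"
        using J' by (intro sum.cong) (auto simp: l'_def)
      then show ?thesis using J' by (simp add: l'_def)
    qed
    have "(\<Sum>j\<in>J. a i j * l' j) = 0" if "i < Suc m" for i
    proof (cases "i = m")
      case True
      then show ?thesis using p by (simp add: l'J s_def)
    next
      case False
      then have "(\<Sum>j\<in>J'. b i j * l j) = 0" using l that by auto
      moreover have "(\<Sum>j\<in>J'. b i j * l j) = (\<Sum>j\<in>J'. a i j * l j) - a i p * s / a m p"
        by (simp add: b_def s_def left_diff_distrib sum_subtractf sum_distrib_left sum_divide_distrib mult.assoc)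
      ultimately show ?thesis by (simp add: l'J)
    qed
    moreover have "\<exists>j\<in>J. l' j \<noteq> 0" using l J' by (auto simp: l'_def)
    ultimately show ?thesis by blast
  qed
qed

text \<open>The coordinates give \<open>n\<close> equations and the constant row
  \<open>a n t = 1\<close> one more, hence the threshold \<open>n + 1\<close>. This last equation
  makes the coefficients sum to 0, so a nontrivial solution has a positive one.\<close>

lemma affine_dependence_vec:
  assumes T: "finite T" "T \<subseteq> carrier_vec n" "n + 1 < card T"
  shows "\<exists>l. (\<exists>t\<in>T. l t > (0::real)) \<and> (\<Sum>t\<in>T. l t) = 0 \<and>
    (\<forall>x\<in>carrier_vec n. (\<Sum>t\<in>T. l t * (t \<bullet> x)) = 0)"
proof -
  define a where "a i t = (if i < n then t $ i else (1::real))" for i and t :: "real vec"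
  obtain l where l: "\<exists>j\<in>T. l j \<noteq> 0" "\<forall>i<n+1. (\<Sum>t\<in>T. a i t * l t) = 0"
    using homogeneous_system_nontrivial_solution[of T "n+1" a] T by auto
  have s: "(\<Sum>t\<in>T. l t) = 0" using l(2)[rule_format, of n] by (simp add: a_def)
  have "\<exists>t\<in>T. l t > 0"
  proof (rule ccontr)
    assume "\<not> ?thesis"
    then have "\<forall>t\<in>T. l t \<le> 0" by force
    then have "\<forall>t\<in>T. l t = 0" using s T(1) sum_nonneg_eq_0_iff[of T "\<lambda>t. - l t"] by (auto simp: sum_negf)
    then show False using l by auto
  qed
  moreover have "(\<Sum>t\<in>T. l t * (t \<bullet> x)) = 0" if "x \<in> carrier_vec n" for x
  proof -
    have "(\<Sum>t\<in>T. l t * (t \<bullet> x)) = (\<Sum>t\<in>T. \<Sum>i<n. a i t * l t * x $ i)"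
      using that T(2)
      by (intro sum.cong) (auto simp: scalar_prod_def a_def sum_distrib_left mult_ac lessThan_atLeast0)
    also have "\<dots> = (\<Sum>i<n. (\<Sum>t\<in>T. a i t * l t) * x $ i)"
      by (subst sum.swap) (simp add: sum_distrib_right)
    also have "\<dots> = 0" using l by simp
    finally show ?thesis .
  qed
  ultimately show ?thesis using s by blast
qed

lemma Max_insert_below:
  fixes f :: "'a \<Rightarrow> real"
  assumes "finite A" "a \<in> A" "f p \<le> f a"
  shows "Max (f ` insert p A) = Max (f ` A)"
proof -
  have "f p \<le> Max (f ` A)" using assms by (intro order.trans[OF assms(3)] Max_ge) auto
  then show ?thesis using assms by (subst image_insert, subst Max_insert) auto
qed

text \<open>Pair each \<open>U\<close> not containing \<open>p\<close> with
  \<open>insert p U\<close>. As \<open>q\<close> lies outside \<open>P\<close>, it survives in every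
  \<open>T - U\<close> and dominates \<open>p\<close> there, so the two maxima agree while their
  signs are opposite.\<close>

lemma alternating_sum_Max_eq_0:
  fixes f :: "'a \<Rightarrow> real"
  assumes "finite T" "P \<subseteq> T" "p \<in> P" "q \<in> T - P" "f p \<le> f q"
  shows "(\<Sum>U\<in>Pow P. (-1) ^ card U * Max (f ` (T - U))) = 0"
proof -
  define g where "g U = (-1) ^ card U * Max (f ` (T - U))" for U
  define Q where "Q = P - {p}"
  have fin: "finite P" using assms finite_subset by auto
  have P: "P = insert p Q" "p \<notin> Q" "finite Q" using assms fin by (auto simp: Q_def)
  have "g (insert p U) = - g U" if "U \<in> Pow Q" for U
  proof -
    have U: "finite U" "p \<notin> U" using that P finite_subset by auto
    have e: "T - U = insert p (T - insert p U)" using assms U by auto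
    have "Max (f ` (T - U)) = Max (f ` (T - insert p U))"
      unfolding e by (rule Max_insert_below[of _ q]) (use assms that P in auto)
    then show ?thesis using U by (simp add: g_def)
  qed
  moreover have "inj_on (insert p) (Pow Q)" using P by (auto simp: inj_on_def)
  ultimately have "sum g (insert p ` Pow Q) = - sum g (Pow Q)"
    by (simp add: sum.reindex sum_negf)
  moreover have "sum g (Pow P) = sum g (Pow Q) + sum g (insert p ` Pow Q)"
    unfolding P(1) Pow_insert using P by (intro sum.union_disjoint) auto
  ultimately show ?thesis by (simp add: g_def)
qed

text \<open>
  Wang and Sun: in an affine dependence of the linear forms in \<open>T\<close>, the forms with positive
  coefficients cannot all exceed all the remaining ones, so the alternating sum vanishes
  and expresses the maximum over \<open>T\<close> through maxima over proper subsets.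
\<close>

lemma Max_scalar_prod_reduce:
  assumes T: "finite T" "T \<subseteq> carrier_vec n" "n + 1 < card T"
  shows "\<exists>P c. P \<subseteq> T \<and> P \<noteq> {} \<and> P \<noteq> T \<and>
    (\<forall>x\<in>carrier_vec n. Max ((\<lambda>t. t \<bullet> x) ` T) =
      (\<Sum>U\<in>Pow P - {{}}. c U * Max ((\<lambda>t. t \<bullet> (x :: real vec)) ` (T - U))))"
proof -
  obtain l where l: "\<exists>t\<in>T. l t > (0::real)" "(\<Sum>t\<in>T. l t) = 0"
    "\<forall>x\<in>carrier_vec n. (\<Sum>t\<in>T. l t * (t \<bullet> x)) = 0"
    using affine_dependence_vec[OF T] by auto
  define P where "P = {t\<in>T. l t > 0}"
  have P: "P \<subseteq> T" "P \<noteq> {}" "finite P" using l T(1) by (auto simp: P_def)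
  have "P \<noteq> T"
  proof
    assume "P = T"
    then have "sum l T > 0" using P by (intro sum_pos) (auto simp: P_def)
    then show False using l by simp
  qed
  have "Max ((\<lambda>t. t \<bullet> x) ` T) =
      (\<Sum>U\<in>Pow P - {{}}. (- ((-1) ^ card U)) * Max ((\<lambda>t. t \<bullet> x) ` (T - U)))"
    if x: "x \<in> carrier_vec n" for x
  proof -
    have "\<exists>p\<in>P. \<exists>q\<in>T-P. p \<bullet> x \<le> q \<bullet> x"
    proof (rule ccontr)
      assume "\<not> ?thesis"
      then have lt: "\<And>p q. p \<in> P \<Longrightarrow> q \<in> T - P \<Longrightarrow> q \<bullet> x < p \<bullet> x" by (meson not_le)
      \<comment> \<open>The threshold \<open>m\<close> separates the values on \<open>P\<close> from
        those on \<open>T - P\<close>. Every \<open>l t * (t \<bullet> x - m)\<close> is then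
        nonnegative, yet they add up to 0, so \<open>l\<close> vanishes off \<open>P\<close> and its
        sum over \<open>T\<close> would be positive.\<close>
      define m where "m = Min ((\<lambda>t. t \<bullet> x) ` P)"
      have "m \<in> (\<lambda>t. t \<bullet> x) ` P" unfolding m_def using P by (intro Min_in) auto
      then obtain p0 where p0: "p0 \<in> P" "m = p0 \<bullet> x" by auto
      have m: "m \<le> p \<bullet> x" if "p \<in> P" for p unfolding m_def using P that by auto
      have nn: "0 \<le> l t * (t \<bullet> x - m)" if "t \<in> T" for t
        using that m[of t] lt[of p0 t] p0
        by (cases "t \<in> P") (auto simp: P_def intro!: mult_nonneg_nonneg mult_nonpos_nonpos)
      have z: "(\<Sum>t\<in>T. l t * (t \<bullet> x - m)) = 0"
        using l x by (simp add: right_diff_distrib sum_subtractf flip: sum_distrib_right)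
      then have all0: "\<forall>t\<in>T. l t * (t \<bullet> x - m) = 0"
        using sum_nonneg_eq_0_iff[of T "\<lambda>t. l t * (t \<bullet> x - m)"] T(1) nn by blast
      have "l t = 0" if "t \<in> T - P" for t
        using all0 lt[OF p0(1) that] p0 that by auto
      then have "sum l T = sum l P" using P T by (intro sum.mono_neutral_right) auto
      moreover have "sum l P > 0" using P by (intro sum_pos) (auto simp: P_def)
      ultimately show False using l by simp
    qed
    then obtain p q where pq: "p \<in> P" "q \<in> T - P" "p \<bullet> x \<le> q \<bullet> x" by auto
    have "(\<Sum>U\<in>Pow P. (-1) ^ card U * Max ((\<lambda>t. t \<bullet> x) ` (T - U))) = 0"
      by (rule alternating_sum_Max_eq_0[of T P p q "\<lambda>t. t \<bullet> x"]) (use T P pq in auto)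
    \<comment> \<open>The summand for \<open>U = {}\<close> is the maximum over \<open>T\<close>
      itself; solving for it gives the coefficients.\<close>
    then show ?thesis
      using P(3) by (subst (asm) sum.remove[of _ "{}"]) (auto simp: sum_negf)
  qed
  then show ?thesis using P \<open>P \<noteq> T\<close>
    by (intro exI[of _ P] exI[of _ "\<lambda>U. - ((-1) ^ card U)"]) auto
qed

definition small_subsets :: "nat \<Rightarrow> 'a set \<Rightarrow> 'a set set" where
  "small_subsets m T = {U. U \<subseteq> T \<and> U \<noteq> {} \<and> card U \<le> m}"

text \<open>Iterates the reduction until no set has more than \<open>n + 1\<close> elements:
  \<open>U \<noteq> {}\<close> makes \<open>T - U\<close> smaller, \<open>P \<noteq> T\<close> keeps
  it nonempty.\<close>

lemma Max_scalar_prod_decompose: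
  assumes T: "finite T" "T \<subseteq> carrier_vec n" "T \<noteq> {}"
  shows "\<exists>c. \<forall>x\<in>carrier_vec n. Max ((\<lambda>t. t \<bullet> x) ` T) =
    (\<Sum>U\<in>small_subsets (n + 1) T. c U * Max ((\<lambda>t. t \<bullet> (x :: real vec)) ` U))"
  using assms
proof (induction "card T" arbitrary: T rule: less_induct)
  case less
  have fin: "finite (small_subsets m T)" for m using less.prems(1) by (auto simp: small_subsets_def)
  show ?case
  proof (cases "card T \<le> n + 1")
    case True
    then have "T \<in> small_subsets (n + 1) T" using less.prems by (auto simp: small_subsets_def)
    then show ?thesis using fin
      by (intro exI[of _ "\<lambda>U. if U = T then 1 else 0"])
        (simp add: if_distrib[of "\<lambda>c. c * _"] cong: if_cong)
  next
    case False
    then obtain P c where P: "P \<subseteq> T" "P \<noteq> {}" "P \<noteq> T" and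
      c: "\<forall>x\<in>carrier_vec n. Max ((\<lambda>t. t \<bullet> x) ` T) =
        (\<Sum>U\<in>Pow P - {{}}. c U * Max ((\<lambda>t. t \<bullet> (x :: real vec)) ` (T - U)))"
      using Max_scalar_prod_reduce[of T n] less.prems by auto
    have "\<forall>U\<in>Pow P - {{}}. \<exists>d. \<forall>x\<in>carrier_vec n. Max ((\<lambda>t. t \<bullet> x) ` (T - U)) =
        (\<Sum>W\<in>small_subsets (n + 1) (T - U). d W * Max ((\<lambda>t. t \<bullet> (x :: real vec)) ` W))"
    proof
      fix U assume U: "U \<in> Pow P - {{}}"
      have "card (T - U) < card T" using U P less.prems by (intro psubset_card_mono) auto
      then show "\<exists>d. \<forall>x\<in>carrier_vec n. Max ((\<lambda>t. t \<bullet> x) ` (T - U)) =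
          (\<Sum>W\<in>small_subsets (n + 1) (T - U). d W * Max ((\<lambda>t. t \<bullet> (x :: real vec)) ` W))"
        by (rule less.hyps) (use U P less.prems in auto)
    qed
    from bchoice[OF this] obtain d where d: "\<forall>U\<in>Pow P - {{}}. \<forall>x\<in>carrier_vec n.
        Max ((\<lambda>t. t \<bullet> x) ` (T - U)) =
        (\<Sum>W\<in>small_subsets (n + 1) (T - U). d U W * Max ((\<lambda>t. t \<bullet> (x :: real vec)) ` W))"
      by (elim exE)
    \<comment> \<open>Extension by 0 to a common index set, so that the sums over \<open>U\<close>
      and \<open>W\<close> can be interchanged.\<close>
    define e where "e U W = (if W \<in> small_subsets (n + 1) (T - U) then d U W else 0)" for U W
    have e: "Max ((\<lambda>t. t \<bullet> x) ` (T - U)) =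
        (\<Sum>W\<in>small_subsets (n + 1) T. e U W * Max ((\<lambda>t. t \<bullet> (x :: real vec)) ` W))"
      if "U \<in> Pow P - {{}}" "x \<in> carrier_vec n" for U x
      unfolding d[rule_format, OF that] using fin
      by (intro sum.mono_neutral_cong_left) (auto simp: e_def small_subsets_def)
    show ?thesis
    proof (intro exI ballI)
      fix x :: "real vec" assume x: "x \<in> carrier_vec n"
      have "Max ((\<lambda>t. t \<bullet> x) ` T) = (\<Sum>U\<in>Pow P - {{}}. c U *
          (\<Sum>W\<in>small_subsets (n + 1) T. e U W * Max ((\<lambda>t. t \<bullet> x) ` W)))"
        using c x e by simp
      also have "\<dots> = (\<Sum>W\<in>small_subsets (n + 1) T. (\<Sum>U\<in>Pow P - {{}}. c U * e U W) *
          Max ((\<lambda>t. t \<bullet> x) ` W))"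
        by (simp add: sum_distrib_left sum_distrib_right mult.assoc) (rule sum.swap)
      finally show "Max ((\<lambda>t. t \<bullet> x) ` T) = \<dots>" .
    qed
  qed
qed

text \<open>Enumeration with repetitions, spare places being filled with a fixed \<open>u\<close>.
  It serves to count small subsets as tuples and to fill the \<open>2 ^ h\<close> places of a
  tournament.\<close>

lemma ex_image_lessThan_eq:
  assumes "finite U" "U \<noteq> {}" "card U \<le> m"
  shows "\<exists>g. g ` {..<m::nat} = U"
proof -
  obtain u where u: "u \<in> U" using assms by auto
  obtain b where b: "b ` {..<card U} = U"
    using ex_bij_betw_nat_finite[OF assms(1)] by (auto simp: bij_betw_def atLeast0LessThan)
  have "(\<lambda>i. if i < card U then b i else u) ` {..<m} = U"
  proof
    show "(\<lambda>i. if i < card U then b i else u) ` {..<m} \<subseteq> U" using b u by auto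
    show "U \<subseteq> (\<lambda>i. if i < card U then b i else u) ` {..<m}"
    proof
      fix v assume "v \<in> U"
      then obtain i where "i < card U" "v = b i" using b by auto
      then show "v \<in> (\<lambda>i. if i < card U then b i else u) ` {..<m}"
        using assms by (intro image_eqI[of _ _ i]) auto
    qed
  qed
  then show ?thesis by blast
qed

lemma card_small_subsets_le:
  assumes T: "finite T"
  shows "card (small_subsets m T) \<le> card T ^ m"
proof -
  have "small_subsets m T \<subseteq> (\<lambda>g. g ` {..<m}) ` (PiE {..<m} (\<lambda>_. T))"
  proof
    fix U assume U: "U \<in> small_subsets m T"
    then have "finite U" "U \<noteq> {}" "card U \<le> m" "U \<subseteq> T"
      using T finite_subset by (auto simp: small_subsets_def)
    then obtain g where g: "g ` {..<m} = U" using ex_image_lessThan_eq[of U m] by auto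
    then have "restrict g {..<m} ` {..<m} = U" "restrict g {..<m} \<in> PiE {..<m} (\<lambda>_. T)"
      using \<open>U \<subseteq> T\<close> by auto
    then show "U \<in> (\<lambda>g. g ` {..<m}) ` (PiE {..<m} (\<lambda>_. T))" by blast
  qed
  then have "card (small_subsets m T) \<le> card (PiE {..<m} (\<lambda>_. T))"
    using T by (intro surj_card_le) (auto intro: finite_PiE)
  also have "\<dots> = card T ^ m" using T by (simp add: card_PiE)
  finally show ?thesis .
qed

subsection \<open>Networks for maxima of linear forms\<close>

text \<open>The leaves below root \<open>j\<close> in a forest of binary tournaments with
  \<open>h\<close> rounds, so that one list of forms serves all tournaments in parallel.\<close>

definition dyadic_block :: "nat \<Rightarrow> nat \<Rightarrow> nat set" where
  "dyadic_block h j = {j * 2 ^ h ..< Suc j * 2 ^ h}"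

text \<open>The first round pairs the leaves \<open>2 * i\<close> and \<open>2 * i + 1\<close>; the
  winners, numbered by \<open>i\<close>, again form block number \<open>j\<close>, one round
  shorter.\<close>

lemma Max_dyadic_block_Suc:
  fixes f :: "nat \<Rightarrow> real"
  shows "Max (f ` dyadic_block (Suc h) j) = Max ((\<lambda>i. max (f (2 * i)) (f (2 * i + 1))) ` dyadic_block h j)"
proof (rule antisym)
  have ne: "dyadic_block k j \<noteq> {}" "finite (dyadic_block k j)" for k by (auto simp: dyadic_block_def)
  show "Max (f ` dyadic_block (Suc h) j) \<le> Max ((\<lambda>i. max (f (2 * i)) (f (2 * i + 1))) ` dyadic_block h j)"
  proof (rule Max.boundedI)
    fix y assume "y \<in> f ` dyadic_block (Suc h) j"
    then obtain i where i: "i \<in> dyadic_block (Suc h) j" "y = f i" by auto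
    define m where "m = i div 2"
    have "j * 2 ^ h \<le> m"
      using i(1) by (auto simp: m_def dyadic_block_def less_eq_div_iff_mult_less_eq)
    moreover have "m < Suc j * 2 ^ h"
      using i(1) by (auto simp: m_def dyadic_block_def less_mult_imp_div_less algebra_simps)
    ultimately have "m \<in> dyadic_block h j" by (simp add: dyadic_block_def)
    then have "max (f (2 * m)) (f (2 * m + 1)) \<le> Max ((\<lambda>i. max (f (2 * i)) (f (2 * i + 1))) ` dyadic_block h j)"
      using ne by (intro Max_ge) auto
    moreover have "i = 2 * m \<or> i = 2 * m + 1" by (auto simp: m_def)
    ultimately show "y \<le> Max ((\<lambda>i. max (f (2 * i)) (f (2 * i + 1))) ` dyadic_block h j)"
      using i by auto
  qed (use ne in auto)
  show "Max ((\<lambda>i. max (f (2 * i)) (f (2 * i + 1))) ` dyadic_block h j) \<le> Max (f ` dyadic_block (Suc h) j)"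
  proof (rule Max.boundedI)
    fix y assume "y \<in> (\<lambda>i. max (f (2 * i)) (f (2 * i + 1))) ` dyadic_block h j"
    then obtain i where i: "i \<in> dyadic_block h j" "y = max (f (2 * i)) (f (2 * i + 1))" by auto
    have "2 * i \<in> dyadic_block (Suc h) j" "2 * i + 1 \<in> dyadic_block (Suc h) j"
      using i by (auto simp: dyadic_block_def)
    then show "y \<le> Max (f ` dyadic_block (Suc h) j)" using ne i by (auto intro!: Max_ge)
  qed (use ne in auto)
qed

text \<open>
  One hidden layer computes \<open>N\<close> pairwise maxima of \<open>2 * N\<close> linear forms with three neurons per
  pair, since \<open>max s t = max 0 (s - t) + max 0 t - max 0 (- t)\<close>.
\<close>

definition pair_row :: "(nat \<Rightarrow> real vec) \<Rightarrow> nat \<Rightarrow> real vec" where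
  "pair_row a m = (let i = m div 3 in
     if m mod 3 = 0 then a (2 * i) - a (2 * i + 1)
     else if m mod 3 = 1 then a (2 * i + 1) else - a (2 * i + 1))"

definition pair_layer :: "nat \<Rightarrow> nat \<Rightarrow> (nat \<Rightarrow> real vec) \<Rightarrow> real mat" where
  "pair_layer n N a = mat (3 * N) n (\<lambda>(m, k). pair_row a m $ k)"

text \<open>Recovers the maximum of pair \<open>i\<close> from its three neurons. Being linear, it
  is absorbed into the weights of the next layer, so a round costs only one hidden layer.\<close>

definition pair_form :: "nat \<Rightarrow> nat \<Rightarrow> real vec" where
  "pair_form N i = unit_vec (3 * N) (3 * i) + unit_vec (3 * N) (3 * i + 1) - unit_vec (3 * N) (3 * i + 2)"

lemma pair_form_carrier [simp]: "pair_form N i \<in> carrier_vec (3 * N)"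
  by (simp add: pair_form_def)

lemma pair_form_layer:
  assumes a: "\<And>i. i < 2 * N \<Longrightarrow> a i \<in> carrier_vec n" and x: "x \<in> carrier_vec n" and i: "i < N"
  shows "pair_form N i \<bullet> relu_vec (pair_layer n N a *\<^sub>v x + 0\<^sub>v (3 * N))
    = max (a (2 * i) \<bullet> x) (a (2 * i + 1) \<bullet> x)"
proof -
  define y where "y = relu_vec (pair_layer n N a *\<^sub>v x + 0\<^sub>v (3 * N))"
  have L: "pair_layer n N a \<in> carrier_mat (3 * N) n" by (simp add: pair_layer_def)
  have y: "y \<in> carrier_vec (3 * N)" using L x by (simp add: y_def relu_vec_def)
  have pr: "pair_row a m \<in> carrier_vec n" if "m < 3 * N" for m
  proof -
    have "m div 3 < N" using that by (simp add: less_mult_imp_div_less mult.commute)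
    then have "a (2 * (m div 3)) \<in> carrier_vec n" "a (2 * (m div 3) + 1) \<in> carrier_vec n"
      by (auto intro!: a)
    then show ?thesis by (simp add: pair_row_def Let_def)
  qed
  have ym: "y $ m = max 0 (pair_row a m \<bullet> x)" if "m < 3 * N" for m
  proof -
    have "row (pair_layer n N a) m = pair_row a m"
      using pr[OF that] that by (intro eq_vecI) (auto simp: pair_layer_def)
    then show ?thesis using that L x by (simp add: y_def relu_vec_def)
  qed
  have c: "a (2 * i) \<in> carrier_vec n" "a (2 * i + 1) \<in> carrier_vec n" using i by (auto intro!: a)
  have d: "(3 * i + 1) div 3 = i" "(3 * i + 1) mod 3 = 1" "(3 * i + 2) div 3 = i" "(3 * i + 2) mod 3 = 2"
    by presburger+
  have "pair_form N i \<bullet> y = y $ (3 * i) + y $ (3 * i + 1) - y $ (3 * i + 2)"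
    using y i by (simp add: pair_form_def minus_scalar_prod_distrib[of _ "3 * N"]
        add_scalar_prod_distrib[of _ "3 * N"])
  also have "\<dots> = max 0 (a (2 * i) \<bullet> x - a (2 * i + 1) \<bullet> x) + max 0 (a (2 * i + 1) \<bullet> x)
      - max 0 (- (a (2 * i + 1) \<bullet> x))"
    using i c x d by (simp add: ym pair_row_def Let_def minus_scalar_prod_distrib[of _ n])
  also have "\<dots> = max (a (2 * i) \<bullet> x) (a (2 * i + 1) \<bullet> x)" by (auto simp: max_def)
  finally show ?thesis by (simp add: y_def)
qed

text \<open>After the first layer the winners are the linear forms \<open>pair_form N\<close> of its
  output, so the remaining rounds are the same problem in dimension \<open>3 * N\<close>; hence the
  induction varies \<open>n\<close> and \<open>a\<close>. The first layer is the widest, as every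
  round halves the number of forms.\<close>

lemma relu_net_Max_dyadic_blocks:
  fixes c :: "nat \<Rightarrow> real"
  assumes "\<forall>i<r * 2 ^ h. a i \<in> carrier_vec n"
  shows "\<exists>Ls U. length Ls = h \<and> compatible_layers n Ls U 1 \<and>
    (\<forall>L\<in>set Ls. dim_row (fst L) \<le> 3 * r * 2 ^ (h - 1)) \<and>
    (\<forall>x\<in>carrier_vec n. U *\<^sub>v hidden_layers_eval Ls x =
      vec 1 (\<lambda>_. \<Sum>j<r. c j * Max ((\<lambda>i. a i \<bullet> x) ` dyadic_block h j)))"
  using assms
proof (induction h arbitrary: n a)
  case 0
  define U where "U = mat 1 n (\<lambda>(_, k). \<Sum>j<r. c j * a j $ k)"
  have "U *\<^sub>v x = vec 1 (\<lambda>_. \<Sum>j<r. c j * Max ((\<lambda>i. a i \<bullet> x) ` dyadic_block 0 j))"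
    if x: "x \<in> carrier_vec n" for x
  proof (rule eq_vecI)
    fix i assume "i < dim_vec (vec 1 (\<lambda>_. \<Sum>j<r. c j * Max ((\<lambda>i. a i \<bullet> x) ` dyadic_block 0 j)))"
    then have i: "i = 0" by simp
    have "(U *\<^sub>v x) $ 0 = (\<Sum>k<n. (\<Sum>j<r. c j * a j $ k) * x $ k)"
      using x by (simp add: U_def scalar_prod_def lessThan_atLeast0)
    also have "\<dots> = (\<Sum>j<r. \<Sum>k<n. c j * a j $ k * x $ k)"
      by (subst sum.swap) (simp add: sum_distrib_right)
    also have "\<dots> = (\<Sum>j<r. c j * (a j \<bullet> x))"
      using x by (simp add: scalar_prod_def lessThan_atLeast0 sum_distrib_left mult.assoc)
    also have "\<dots> = (\<Sum>j<r. c j * Max ((\<lambda>i. a i \<bullet> x) ` dyadic_block 0 j))"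
      by (simp add: dyadic_block_def)
    finally show "(U *\<^sub>v x) $ i = vec 1 (\<lambda>_. \<Sum>j<r. c j * Max ((\<lambda>i. a i \<bullet> x) ` dyadic_block 0 j)) $ i"
      using i by simp
  qed (simp add: U_def)
  then show ?case by (intro exI[of _ "[]"] exI[of _ U]) (simp add: U_def)
next
  case (Suc h)
  define N where "N = r * 2 ^ h"
  have a: "a i \<in> carrier_vec n" if "i < 2 * N" for i using Suc.prems that by (simp add: N_def mult_ac)
  have "\<forall>i<r * 2 ^ h. pair_form N i \<in> carrier_vec (3 * N)" by simp
  from Suc.IH[of "pair_form N" "3 * N", OF this] obtain Ls U where IH: "length Ls = h" "compatible_layers (3 * N) Ls U 1"
    "\<forall>L\<in>set Ls. dim_row (fst L) \<le> 3 * r * 2 ^ (h - 1)"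
    "\<forall>x\<in>carrier_vec (3 * N). U *\<^sub>v hidden_layers_eval Ls x =
      vec 1 (\<lambda>_. \<Sum>j<r. c j * Max ((\<lambda>i. pair_form N i \<bullet> x) ` dyadic_block h j))"
    by (elim exE conjE)
  define W where "W = pair_layer n N a"
  have W: "W \<in> carrier_mat (3 * N) n" by (simp add: W_def pair_layer_def)
  have "U *\<^sub>v hidden_layers_eval ((W, 0\<^sub>v (3 * N)) # Ls) x =
      vec 1 (\<lambda>_. \<Sum>j<r. c j * Max ((\<lambda>i. a i \<bullet> x) ` dyadic_block (Suc h) j))"
    if x: "x \<in> carrier_vec n" for x
  proof -
    define y where "y = relu_vec (W *\<^sub>v x + 0\<^sub>v (3 * N))"
    have y: "y \<in> carrier_vec (3 * N)" using W x by (simp add: y_def relu_vec_def)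
    have "Max ((\<lambda>i. pair_form N i \<bullet> y) ` dyadic_block h j) = Max ((\<lambda>i. a i \<bullet> x) ` dyadic_block (Suc h) j)"
      if j: "j < r" for j
    proof -
      have "i < N" if "i \<in> dyadic_block h j" for i
      proof -
        have "i < Suc j * 2 ^ h" using that by (simp add: dyadic_block_def)
        also have "\<dots> \<le> N" unfolding N_def using j by (intro mult_right_mono) auto
        finally show ?thesis .
      qed
      then have "(\<lambda>i. pair_form N i \<bullet> y) ` dyadic_block h j =
          (\<lambda>i. max (a (2 * i) \<bullet> x) (a (2 * i + 1) \<bullet> x)) ` dyadic_block h j"
        unfolding y_def W_def using a x by (intro image_cong refl pair_form_layer) auto
      then show ?thesis using Max_dyadic_block_Suc[of "\<lambda>i. a i \<bullet> x"] by simp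
    qed
    then show ?thesis using IH(4) y by (simp add: y_def)
  qed
  moreover have "dim_row (fst L) \<le> 3 * r * 2 ^ h" if "L \<in> set ((W, 0\<^sub>v (3 * N)) # Ls)" for L
  proof (cases "L = (W, 0\<^sub>v (3 * N))")
    case True
    then show ?thesis using W by (simp add: N_def)
  next
    case False
    then have "dim_row (fst L) \<le> 3 * r * 2 ^ (h - 1)" using that IH(3) by auto
    also have "\<dots> \<le> 3 * r * 2 ^ h" by (intro mult_left_mono power_increasing) auto
    finally show ?thesis .
  qed
  ultimately show ?case using IH(1,2) W
    by (intro exI[of _ "(W, 0\<^sub>v (3 * N)) # Ls"] exI[of _ U]) auto
qed

lemma relu_net_Max_family:
  fixes c :: "real vec set \<Rightarrow> real"
  assumes F: "finite F" and U: "\<forall>U\<in>F. finite U \<and> U \<noteq> {} \<and> card U \<le> 2 ^ h \<and> U \<subseteq> carrier_vec n"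
  shows "\<exists>Ls W. length Ls = h \<and> compatible_layers n Ls W 1 \<and>
    (\<forall>L\<in>set Ls. dim_row (fst L) \<le> 3 * card F * 2 ^ (h - 1)) \<and>
    (\<forall>x\<in>carrier_vec n. W *\<^sub>v hidden_layers_eval Ls x =
      vec 1 (\<lambda>_. \<Sum>U\<in>F. c U * Max ((\<lambda>t. t \<bullet> x) ` U)))"
proof -
  obtain e where e: "bij_betw e {..<card F} F"
    using ex_bij_betw_nat_finite[OF F] by (auto simp: atLeast0LessThan)
  have eF: "e j \<in> F" if "j < card F" for j using e that by (auto simp: bij_betw_def)
  have "\<forall>U\<in>F. \<exists>g. g ` {..<(2::nat) ^ h} = U" by (intro ballI ex_image_lessThan_eq) (use U in auto)
  from bchoice[OF this] obtain g where g: "\<forall>U\<in>F. g U ` {..<(2::nat) ^ h} = U" by (elim exE)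
  \<comment> \<open>The sets are laid out one after another in \<open>2 ^ h\<close> consecutive
    places each: form \<open>i\<close> is number \<open>i mod 2 ^ h\<close> of set number
    \<open>i div 2 ^ h\<close>.\<close>
  define a where "a i = g (e (i div 2 ^ h)) (i mod 2 ^ h)" for i
  have block: "a ` dyadic_block h j = e j" if j: "j < card F" for j
  proof -
    have "dyadic_block h j = (\<lambda>i. j * 2 ^ h + i) ` {..<2 ^ h}"
      by (simp add: dyadic_block_def lessThan_atLeast0 image_add_atLeastLessThan add.commute)
    then have "a ` dyadic_block h j = (\<lambda>i. a (j * 2 ^ h + i)) ` {..<2 ^ h}" by (simp add: image_image)
    also have "\<dots> = g (e j) ` {..<2 ^ h}" by (intro image_cong) (auto simp: a_def)
    also have "\<dots> = e j" using g eF[OF j] by auto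
    finally show ?thesis .
  qed
  have "\<forall>i<card F * 2 ^ h. a i \<in> carrier_vec n"
  proof (intro allI impI)
    fix i assume "i < card F * 2 ^ h"
    then have "e (i div 2 ^ h) \<in> F" by (intro eF) (simp add: less_mult_imp_div_less)
    then have "g (e (i div 2 ^ h)) ` {..<2 ^ h} = e (i div 2 ^ h)" "e (i div 2 ^ h) \<subseteq> carrier_vec n"
      using g U by blast+
    then have "a i \<in> e (i div 2 ^ h)" "e (i div 2 ^ h) \<subseteq> carrier_vec n" by (auto simp: a_def)
    then show "a i \<in> carrier_vec n" by blast
  qed
  from relu_net_Max_dyadic_blocks[of "card F" h a n "\<lambda>j. c (e j)", OF this]
  obtain Ls W where *: "length Ls = h" "compatible_layers n Ls W 1"
    "\<forall>L\<in>set Ls. dim_row (fst L) \<le> 3 * card F * 2 ^ (h - 1)"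
    "\<forall>x\<in>carrier_vec n. W *\<^sub>v hidden_layers_eval Ls x =
      vec 1 (\<lambda>_. \<Sum>j<card F. c (e j) * Max ((\<lambda>i. a i \<bullet> x) ` dyadic_block h j))"
    by (elim exE conjE)
  have "(\<Sum>j<card F. c (e j) * Max ((\<lambda>i. a i \<bullet> x) ` dyadic_block h j)) =
      (\<Sum>U\<in>F. c U * Max ((\<lambda>t. t \<bullet> x) ` U))" for x
  proof -
    have "(\<Sum>j<card F. c (e j) * Max ((\<lambda>i. a i \<bullet> x) ` dyadic_block h j)) =
        (\<Sum>j<card F. c (e j) * Max ((\<lambda>t. t \<bullet> x) ` e j))"
      by (intro sum.cong refl) (simp add: image_image flip: block)
    also have "\<dots> = (\<Sum>U\<in>F. c U * Max ((\<lambda>t. t \<bullet> x) ` U))"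
      using e by (rule sum.reindex_bij_betw)
    finally show ?thesis .
  qed
  with * show ?thesis by auto
qed

text \<open>The second bound makes \<open>h\<close> rounds enough for \<open>n + 1\<close> forms;
  the third, from \<open>h - 1 < log 2 (n + 1)\<close>, limits the number of pairs per tournament in
  the first round.\<close>

lemma two_power_ceiling_log2:
  assumes "1 \<le> n"
  defines "h \<equiv> nat \<lceil>log 2 (real n + 1)\<rceil>"
  shows "1 \<le> h" "n + 1 \<le> 2 ^ h" "2 ^ (h - 1) \<le> n"
proof -
  have l: "0 < log 2 (real n + 1)" using assms by simp
  show h1: "1 \<le> h" using l unfolding h_def by linarith
  have rh: "real h = of_int \<lceil>log 2 (real n + 1)\<rceil>" using l by (simp add: h_def)
  then have "log 2 (real n + 1) \<le> real h" by simp
  then have "real n + 1 \<le> 2 ^ h" by (simp add: log_le_iff powr_realpow)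
  then have "real (n + 1) \<le> real (2 ^ h)" by simp
  then show "n + 1 \<le> 2 ^ h" by (simp only: of_nat_le_iff)
  have "real (h - 1) < log 2 (real n + 1)" using h1 rh by (simp add: of_nat_diff) linarith
  then have "2 ^ (h - 1) < real n + 1" by (simp add: less_log_iff powr_realpow)
  then have "real (2 ^ (h - 1)) < real (n + 1)" by simp
  then have "2 ^ (h - 1) < n + 1" by (simp only: of_nat_less_iff)
  then show "2 ^ (h - 1) \<le> n" by simp
qed

text \<open>There are at most \<open>card T ^ (n + 1)\<close> small subsets, and each occupies at
  most \<open>3 * 2 ^ (h - 1) \<le> 3 * n\<close> neurons of a layer.\<close>

lemma Max_scalar_prod_relu_net:
  assumes n: "1 \<le> n" and T: "finite T" "T \<subseteq> carrier_vec n" "T \<noteq> {}"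
  shows "\<exists>net. represents n net (\<lambda>x. Max ((\<lambda>t. t \<bullet> x) ` T)) \<and>
    relu_net_depth net = nat \<lceil>log 2 (real n + 1)\<rceil> + 1 \<and>
    relu_net_width net \<le> 3 * card T ^ (n + 1) * n"
proof -
  define h where "h = nat \<lceil>log 2 (real n + 1)\<rceil>"
  note h = two_power_ceiling_log2[OF n, folded h_def]
  define F where "F = small_subsets (n + 1) T"
  have F: "finite F" using T by (auto simp: F_def small_subsets_def)
  obtain c where c: "\<forall>x\<in>carrier_vec n. Max ((\<lambda>t. t \<bullet> x) ` T) = (\<Sum>U\<in>F. c U * Max ((\<lambda>t. t \<bullet> x) ` U))"
    using Max_scalar_prod_decompose[OF T] unfolding F_def by (elim exE)
  have "\<forall>U\<in>F. finite U \<and> U \<noteq> {} \<and> card U \<le> 2 ^ h \<and> U \<subseteq> carrier_vec n"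
    using h T finite_subset[of _ T] by (auto simp: F_def small_subsets_def)
  from relu_net_Max_family[OF F this, of c]
  obtain Ls W where *: "length Ls = h" "compatible_layers n Ls W 1"
    "\<forall>L\<in>set Ls. dim_row (fst L) \<le> 3 * card F * 2 ^ (h - 1)"
    "\<forall>x\<in>carrier_vec n. W *\<^sub>v hidden_layers_eval Ls x =
      vec 1 (\<lambda>_. \<Sum>U\<in>F. c U * Max ((\<lambda>t. t \<bullet> x) ` U))"
    by (elim exE conjE)
  have "Ls \<noteq> []" using *(1) h(1) by auto
  have "relu_net_width (Ls, W) \<le> 3 * card F * 2 ^ (h - 1)"
    unfolding relu_net_width_def using *(3) \<open>Ls \<noteq> []\<close> by (intro Max.boundedI) auto
  also have "\<dots> \<le> 3 * card T ^ (n + 1) * n"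
    using h(3) card_small_subsets_le[OF T(1), of "n + 1"] unfolding F_def by (intro mult_mono) auto
  finally have "relu_net_width (Ls, W) \<le> 3 * card T ^ (n + 1) * n" .
  moreover have "relu_net_depth (Ls, W) = h + 1" using * by (simp add: relu_net_depth_def)
  moreover have "represents n (Ls, W) (\<lambda>x. Max ((\<lambda>t. t \<bullet> x) ` T))"
    using * c by (simp add: represents_def relu_net_def relu_net_eval_def)
  ultimately show ?thesis unfolding h_def by blast
qed

subsection \<open>Finite nets for suprema of linear forms\<close>

definition cols_mat :: "nat \<Rightarrow> (nat \<Rightarrow> real vec) \<Rightarrow> real mat" where
  "cols_mat n F = mat n n (\<lambda>(i, j). F j $ i)"

lemma abs_det_le:
  fixes A :: "real mat"
  assumes A: "A \<in> carrier_mat n n" and B: "\<And>i j. i < n \<Longrightarrow> j < n \<Longrightarrow> \<bar>A $$ (i, j)\<bar> \<le> B"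
  shows "\<bar>det A\<bar> \<le> fact n * B ^ n"
proof -
  have "\<bar>det A\<bar> \<le> (\<Sum>p\<in>{p. p permutes {0..<n}}. \<bar>signof p * (\<Prod>i=0..<n. A $$ (i, p i))\<bar>)"
    unfolding det_def'[OF A] by (rule sum_abs)
  also have "\<dots> \<le> (\<Sum>p\<in>{p. p permutes {0..<n}}. B ^ n)"
  proof (rule sum_mono)
    fix p assume "p \<in> {p. p permutes {0..<n}}"
    then have p: "p permutes {0..<n}" by simp
    have "\<bar>signof p * (\<Prod>i=0..<n. A $$ (i, p i))\<bar> = (\<Prod>i=0..<n. \<bar>A $$ (i, p i)\<bar>)"
      by (simp add: abs_mult abs_prod sign_def)
    also have "\<dots> \<le> (\<Prod>i=0..<n. B)"
    proof (rule prod_mono, intro conjI)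
      fix i assume i: "i \<in> {0..<n}"
      then have "p i < n" using permutes_in_image[OF p, of i] by simp
      then show "\<bar>A $$ (i, p i)\<bar> \<le> B" using B i by simp
    qed simp
    finally show "\<bar>signof p * (\<Prod>i=0..<n. A $$ (i, p i))\<bar> \<le> B ^ n" by simp
  qed
  also have "\<dots> = fact n * B ^ n" by (simp add: card_permutations[of "{0..<n}" n])
  finally show ?thesis .
qed

text \<open>
  An approximate Auerbach basis: the elements of \<open>K\<close> that span a parallelepiped of almost maximal
  volume have, by Cramer's rule, almost unit coefficients on \<open>K\<close>.
\<close>

lemma approximate_auerbach_basis:
  fixes K :: "real vec set"
  assumes K: "K \<subseteq> carrier_vec n" and e: "\<And>i. i < n \<Longrightarrow> unit_vec n i \<in> K"
    and B: "\<And>f i. f \<in> K \<Longrightarrow> i < n \<Longrightarrow> \<bar>f $ i\<bar> \<le> B" and b: "1 < b"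
  shows "\<exists>F. (\<forall>k<n. F k \<in> K) \<and> (\<forall>f\<in>K. \<exists>c. (\<forall>k<n. \<bar>c k\<bar> < b) \<and>
    (\<forall>y\<in>carrier_vec n. f \<bullet> y = (\<Sum>k<n. c k * (F k \<bullet> y))))"
proof -
  define \<D> where "\<D> = {\<bar>det (cols_mat n F)\<bar> | F. \<forall>j<n. F j \<in> K}"
  have bdd: "bdd_above \<D>"
  proof (rule bdd_aboveI)
    fix d assume "d \<in> \<D>"
    then obtain F where "d = \<bar>det (cols_mat n F)\<bar>" "\<forall>j<n. F j \<in> K" by (auto simp: \<D>_def)
    then show "d \<le> fact n * B ^ n" using B by (auto simp: cols_mat_def intro!: abs_det_le)
  qed
  have "cols_mat n (unit_vec n) = 1\<^sub>m n" by (intro eq_matI) (auto simp: cols_mat_def unit_vec_def)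
  then have "1 \<in> \<D>" using e by (auto simp: \<D>_def intro!: exI[of _ "unit_vec n"])
  then have s: "1 \<le> Sup \<D>" using bdd by (rule cSup_upper)
  then have "Sup \<D> / b < Sup \<D>" using b by (simp add: divide_less_eq)
  \<comment> \<open>\<open>K\<close> is not assumed closed, so a maximal volume need not be
    attained; the factor \<open>b\<close> makes up for this. The unit vectors make the supremum
    positive.\<close>
  then obtain d where "d \<in> \<D>" "Sup \<D> / b < d" using less_cSupD[of \<D>] \<open>1 \<in> \<D>\<close> by blast
  then obtain F where F: "\<forall>j<n. F j \<in> K" "Sup \<D> / b < \<bar>det (cols_mat n F)\<bar>" by (auto simp: \<D>_def)
  define A where "A = cols_mat n F"
  have A: "A \<in> carrier_mat n n" by (simp add: A_def cols_mat_def)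
  have dA: "det A \<noteq> 0" "Sup \<D> < b * \<bar>det A\<bar>" using F(2) s b by (auto simp: A_def divide_less_eq mult.commute)
  have "\<exists>c. (\<forall>k<n. \<bar>c k\<bar> < b) \<and> (\<forall>y\<in>carrier_vec n. f \<bullet> y = (\<Sum>k<n. c k * (F k \<bullet> y)))"
    if f: "f \<in> K" for f
  proof -
    have fc: "f \<in> carrier_vec n" using f K by auto
    define x where "x = (1 / det A) \<cdot>\<^sub>v (adj_mat A *\<^sub>v f)"
    note adj = adj_mat[OF A]
    have x: "x \<in> carrier_vec n" using adj fc by (simp add: x_def)
    have "A *\<^sub>v x = (1 / det A) \<cdot>\<^sub>v (A *\<^sub>v (adj_mat A *\<^sub>v f))"
      unfolding x_def by (rule mult_mat_vec[OF A]) (use adj fc in auto)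
    also have "A *\<^sub>v (adj_mat A *\<^sub>v f) = (A * adj_mat A) *\<^sub>v f"
      using A adj(1) fc by (simp add: assoc_mult_mat_vec)
    also have "\<dots> = det A \<cdot>\<^sub>v f"
      unfolding adj(2) using fc by (intro eq_vecI) (auto simp: scalar_prod_left_unit)
    also have "(1 / det A) \<cdot>\<^sub>v \<dots> = f" using dA by (intro eq_vecI) auto
    finally have Ax: "A *\<^sub>v x = f" .
    have "\<bar>x $ k\<bar> < b" if k: "k < n" for k
    proof -
      \<comment> \<open>Cramer's rule: \<open>x $ k * det A\<close> is again a signed volume spanned
        by elements of \<open>K\<close>, hence bounded by the supremum.\<close>
      have "replace_col A f k = cols_mat n (F(k := f))"
        by (intro eq_matI) (auto simp: replace_col_def A_def cols_mat_def)
      then have "x $ k * det A = det (cols_mat n (F(k := f)))"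
        using cramer_lemma_mat[OF A x k] Ax by simp
      moreover have "\<bar>det (cols_mat n (F(k := f)))\<bar> \<in> \<D>" unfolding \<D>_def using F f by auto
      ultimately have "\<bar>x $ k\<bar> * \<bar>det A\<bar> \<le> Sup \<D>" using cSup_upper bdd by (metis abs_mult)
      then have "\<bar>x $ k\<bar> * \<bar>det A\<bar> < b * \<bar>det A\<bar>" using dA by linarith
      then show ?thesis using dA by simp
    qed
    moreover have "f \<bullet> y = (\<Sum>k<n. x $ k * (F k \<bullet> y))" if y: "y \<in> carrier_vec n" for y
    proof -
      have "f \<bullet> y = (\<Sum>i<n. (\<Sum>k<n. F k $ i * x $ k) * y $ i)"
        unfolding Ax[symmetric] using x y
        by (simp add: scalar_prod_def A_def cols_mat_def lessThan_atLeast0)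
      also have "\<dots> = (\<Sum>k<n. \<Sum>i<n. F k $ i * x $ k * y $ i)"
        by (subst sum.swap) (simp add: sum_distrib_right)
      also have "\<dots> = (\<Sum>k<n. x $ k * (F k \<bullet> y))"
        using y by (simp add: scalar_prod_def lessThan_atLeast0 sum_distrib_left mult_ac)
      finally show ?thesis .
    qed
    ultimately show ?thesis by (intro exI[of _ "\<lambda>k. x $ k"]) auto
  qed
  with F(1) show ?thesis by blast
qed

lemma sup_seminorm_upper:
  fixes K :: "real vec set"
  assumes B: "\<And>f i. f \<in> K \<Longrightarrow> i < n \<Longrightarrow> \<bar>f $ i\<bar> \<le> B" and x: "x \<in> carrier_vec n" and f: "f \<in> K"
  shows "\<bar>f \<bullet> x\<bar> \<le> (SUP f\<in>K. \<bar>f \<bullet> x\<bar>)"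
proof (rule cSUP_upper[OF f], rule bdd_aboveI2)
  fix f assume f: "f \<in> K"
  have "\<bar>f \<bullet> x\<bar> \<le> (\<Sum>i<n. \<bar>f $ i * x $ i\<bar>)"
    using x by (simp add: scalar_prod_def lessThan_atLeast0)
  also have "\<dots> \<le> (\<Sum>i<n. B * \<bar>x $ i\<bar>)"
    using B[OF f] by (intro sum_mono) (auto simp: abs_mult intro!: mult_right_mono)
  finally show "\<bar>f \<bullet> x\<bar> \<le> (\<Sum>i<n. B * \<bar>x $ i\<bar>)" .
qed

text \<open>
  The grid with \<open>q\<close> cells per axis on the coefficients with respect to an approximate Auerbach
  basis: one representative in \<open>K\<close> per nonempty cell suffices.
\<close>

lemma sup_seminorm_grid_net:
  fixes K :: "real vec set"
  assumes K: "K \<subseteq> carrier_vec n" and ne: "K \<noteq> {}" and e: "\<And>i. i < n \<Longrightarrow> unit_vec n i \<in> K"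
    and B: "\<And>f i. f \<in> K \<Longrightarrow> i < n \<Longrightarrow> \<bar>f $ i\<bar> \<le> B"
    and q: "0 < q" and \<kappa>: "0 \<le> \<kappa>" "\<kappa> < 1 - 2 * real n / real q"
  shows "\<exists>S. finite S \<and> S \<noteq> {} \<and> S \<subseteq> K \<and> card S \<le> q ^ n \<and>
    (\<forall>x\<in>carrier_vec n. \<forall>f\<in>K. \<kappa> * \<bar>f \<bullet> x\<bar> \<le> Max ((\<lambda>g. \<bar>g \<bullet> x\<bar>) ` S))"
proof -
  \<comment> \<open>The slack in the hypothesis on \<open>\<kappa>\<close> is spent on
    \<open>b > 1\<close> such that \<open>\<kappa> \<le> 1 - 2 * n * b / q\<close> still holds. The
    summand 1 in the denominator keeps it positive even for \<open>n = 0\<close>.\<close>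
  define b where "b = 1 + (1 - 2 * real n / real q - \<kappa>) / (2 * real n / real q + 1)"
  have den: "0 < 2 * real n / real q + 1" by (simp add: add_nonneg_pos)
  have b: "1 < b" using \<kappa> den by (simp add: b_def)
  have "2 * real n / real q * (b - 1) \<le> (2 * real n / real q + 1) * (b - 1)"
    using b by (intro mult_right_mono) auto
  also have "\<dots> = 1 - 2 * real n / real q - \<kappa>" using den by (simp add: b_def)
  finally have \<kappa>b: "\<kappa> \<le> 1 - real n * (2 * b / real q)" by (simp add: algebra_simps diff_divide_distrib)
  obtain F where F: "\<forall>k<n. F k \<in> K" and "\<forall>f\<in>K. \<exists>c. (\<forall>k<n. \<bar>c k\<bar> < b) \<and>
    (\<forall>y\<in>carrier_vec n. f \<bullet> y = (\<Sum>k<n. c k * (F k \<bullet> y)))"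
    using approximate_auerbach_basis[OF K e B b] by blast
  from bchoice[OF this(2)] obtain c where c: "\<forall>f\<in>K. (\<forall>k<n. \<bar>c f k\<bar> < b) \<and>
    (\<forall>y\<in>carrier_vec n. f \<bullet> y = (\<Sum>k<n. c f k * (F k \<bullet> y)))" by (elim exE)
  \<comment> \<open>Rescales the coefficients from the range between \<open>- b\<close> and
    \<open>b\<close> to that between 0 and \<open>q\<close>, so that cells are unit intervals; one
    unit is a difference of \<open>2 * b / q\<close>.\<close>
  define u where "u f k = (c f k + b) * (real q / (2 * b))" for f k
  define cell where "cell f = (\<lambda>k\<in>{..<n}. nat \<lfloor>u f k\<rfloor>)" for f
  have u: "0 \<le> u f k" "u f k < real q" if "f \<in> K" "k < n" for f k
  proof -
    have ck: "- b < c f k" "c f k < b" using c that by (force simp: abs_less_iff)+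
    show "0 \<le> u f k" unfolding u_def using ck b by (intro mult_nonneg_nonneg) auto
    have "u f k < (2 * b) * (real q / (2 * b))"
      unfolding u_def using ck b q by (intro mult_strict_right_mono) auto
    then show "u f k < real q" using b by simp
  qed
  define rep where "rep f = inv_into K cell (cell f)" for f
  define S where "S = inv_into K cell ` (cell ` K)"
  have cellK: "cell ` K \<subseteq> PiE {..<n} (\<lambda>_. {..<q})"
  proof
    fix w assume "w \<in> cell ` K"
    then obtain f where f: "f \<in> K" "w = cell f" by auto
    have "nat \<lfloor>u f k\<rfloor> < q" if "k < n" for k
      using u[OF f(1) that] by linarith
    then show "w \<in> PiE {..<n} (\<lambda>_. {..<q})" by (auto simp: f cell_def)
  qed
  have finP: "finite (PiE {..<n} (\<lambda>_. {..<q}))" by (intro finite_PiE) auto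
  have fin: "finite (cell ` K)" using finite_subset[OF cellK finP] .
  have "card S \<le> card (cell ` K)" unfolding S_def using fin by (rule card_image_le)
  also have "\<dots> \<le> card (PiE {..<n} (\<lambda>_. {..<q}))" using finP cellK by (rule card_mono)
  also have "\<dots> = q ^ n" by (simp add: card_PiE)
  finally have card: "card S \<le> q ^ n" .
  have rep: "rep f \<in> K" "rep f \<in> S" "cell (rep f) = cell f" if "f \<in> K" for f
    using that by (auto simp: rep_def S_def inv_into_into f_inv_into_f)
  have SK: "S \<subseteq> K" by (auto simp: S_def inv_into_into)
  have finS: "finite S" using fin by (simp add: S_def)
  have diff: "\<bar>c f k - c (rep f) k\<bar> \<le> 2 * b / real q" if f: "f \<in> K" and k: "k < n" for f k
  proof -
    have "nat \<lfloor>u f k\<rfloor> = nat \<lfloor>u (rep f) k\<rfloor>"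
      using fun_cong[OF rep(3)[OF f], of k] k by (simp add: cell_def)
    then have "\<bar>u f k - u (rep f) k\<bar> \<le> 1"
      using u[OF f k] u[OF rep(1)[OF f] k] by linarith
    moreover have "u f k - u (rep f) k = (c f k - c (rep f) k) * (real q / (2 * b))"
      unfolding u_def by (simp only: left_diff_distrib[symmetric]) simp
    ultimately have "\<bar>c f k - c (rep f) k\<bar> * (real q / (2 * b)) \<le> 1"
      using b by (simp add: abs_mult)
    then show ?thesis using b q by (simp add: field_simps)
  qed
  have "\<kappa> * \<bar>f \<bullet> x\<bar> \<le> Max ((\<lambda>g. \<bar>g \<bullet> x\<bar>) ` S)" if x: "x \<in> carrier_vec n" and f: "f \<in> K" for x f
  proof -
    define s where "s = (SUP f\<in>K. \<bar>f \<bullet> x\<bar>)"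
    define M where "M = Max ((\<lambda>g. \<bar>g \<bullet> x\<bar>) ` S)"
    have s: "\<bar>f \<bullet> x\<bar> \<le> s" if "f \<in> K" for f
      unfolding s_def using B x that by (rule sup_seminorm_upper)
    have s0: "0 \<le> s" using s[OF f] by linarith
    \<comment> \<open>Each basis form \<open>F k\<close> lies in \<open>K\<close>, so its value at
      \<open>x\<close> is at most \<open>s\<close>. Replacing \<open>g\<close> by its representative
      thus costs a multiple of \<open>s\<close> itself, which is then moved to the left-hand
      side.\<close>
    have "s \<le> M + real n * (2 * b / real q) * s"
      unfolding s_def[of]
    proof (rule cSUP_least[OF ne], fold s_def)
      fix g assume g: "g \<in> K"
      have "\<bar>g \<bullet> x - rep g \<bullet> x\<bar> = \<bar>\<Sum>k<n. (c g k - c (rep g) k) * (F k \<bullet> x)\<bar>"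
        using c g rep(1)[OF g] x by (simp add: left_diff_distrib sum_subtractf)
      also have "\<dots> \<le> (\<Sum>k<n. \<bar>(c g k - c (rep g) k) * (F k \<bullet> x)\<bar>)" by (rule sum_abs)
      also have "\<dots> \<le> (\<Sum>k<n. 2 * b / real q * s)"
        unfolding abs_mult using diff[OF g] s F b by (intro sum_mono mult_mono) auto
      also have "\<dots> = real n * (2 * b / real q) * s" by simp
      finally have "\<bar>g \<bullet> x\<bar> \<le> \<bar>rep g \<bullet> x\<bar> + real n * (2 * b / real q) * s" by linarith
      moreover have "\<bar>rep g \<bullet> x\<bar> \<le> M" unfolding M_def using finS rep(2)[OF g] by (intro Max_ge) auto
      ultimately show "\<bar>g \<bullet> x\<bar> \<le> M + real n * (2 * b / real q) * s" by linarith
    qed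
    then have "(1 - real n * (2 * b / real q)) * s \<le> M" by (simp add: algebra_simps)
    moreover have "\<kappa> * s \<le> (1 - real n * (2 * b / real q)) * s" using \<kappa>b s0 by (rule mult_right_mono)
    moreover have "\<kappa> * \<bar>f \<bullet> x\<bar> \<le> \<kappa> * s" using s[OF f] \<kappa>(1) by (rule mult_left_mono)
    ultimately show ?thesis unfolding M_def by linarith
  qed
  then show ?thesis using finS ne SK card by (intro exI[of _ S]) (auto simp: S_def)
qed

text \<open>In dimension 1 all forms are multiples of each other, so a single almost extremal one is
  enough for every precision. A grid that grows with the precision would exceed the facet bound,
  which is constant there.\<close>

lemma sup_seminorm_net_dim_1:
  fixes K :: "real vec set"
  assumes K: "K \<subseteq> carrier_vec 1" and e: "unit_vec 1 0 \<in> K"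
    and B: "\<And>f. f \<in> K \<Longrightarrow> \<bar>f $ 0\<bar> \<le> B" and \<kappa>: "0 < \<kappa>" "\<kappa> < 1"
  shows "\<exists>g\<in>K. \<forall>x\<in>carrier_vec 1. \<forall>f\<in>K. \<kappa> * \<bar>f \<bullet> x\<bar> \<le> \<bar>g \<bullet> x\<bar>"
proof -
  define D where "D = (\<lambda>f. \<bar>f $ 0\<bar>) ` K"
  have bdd: "bdd_above D" unfolding D_def using B by (intro bdd_aboveI2) auto
  have "\<bar>unit_vec 1 0 $ 0 :: real\<bar> \<in> D" unfolding D_def using e by (rule imageI)
  then have D1: "1 \<in> D" by simp
  then have "1 \<le> Sup D" using bdd by (rule cSup_upper)
  then have "\<kappa> * Sup D < Sup D" using \<kappa> by simp
  then obtain d where "d \<in> D" "\<kappa> * Sup D < d" using less_cSupD[of D] D1 by blast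
  then obtain g where g: "g \<in> K" "\<kappa> * Sup D < \<bar>g $ 0\<bar>" by (auto simp: D_def)
  have "\<kappa> * \<bar>f \<bullet> x\<bar> \<le> \<bar>g \<bullet> x\<bar>" if x: "x \<in> carrier_vec 1" and f: "f \<in> K" for x f
  proof -
    have "\<bar>f $ 0\<bar> \<le> Sup D" using f bdd by (intro cSup_upper) (auto simp: D_def)
    then have "\<kappa> * \<bar>f $ 0\<bar> \<le> \<kappa> * Sup D" using \<kappa> by simp
    then have "\<kappa> * \<bar>f $ 0\<bar> \<le> \<bar>g $ 0\<bar>" using g by linarith
    then have "\<kappa> * \<bar>f $ 0\<bar> * \<bar>x $ 0\<bar> \<le> \<bar>g $ 0\<bar> * \<bar>x $ 0\<bar>" by (rule mult_right_mono) simp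
    then show ?thesis using x by (simp add: scalar_prod_def abs_mult mult.assoc)
  qed
  then show ?thesis using g by blast
qed

subsection \<open>Norms and the joint spectral radius\<close>

text \<open>The coordinates of \<open>f\<close> are switched on one at a time. An arbitrary index
  type, with \<open>p\<close> depending only on the values on \<open>I\<close>, admits pairs of
  matrix indices as coordinates.\<close>

lemma seminorm_le_sum_coordinates:
  fixes p :: "('a \<Rightarrow> real) \<Rightarrow> real"
  assumes I: "finite I" and cong: "\<And>f g. (\<forall>i\<in>I. f i = g i) \<Longrightarrow> p f = p g"
    and add: "\<And>f g. p (\<lambda>i. f i + g i) \<le> p f + p g"
    and scale: "\<And>c f. p (\<lambda>i. c * f i) = \<bar>c\<bar> * p f"
  shows "p f \<le> (\<Sum>i\<in>I. \<bar>f i\<bar> * p (\<lambda>j. if j = i then 1 else 0))"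
proof -
  have "p (\<lambda>i. if i \<in> J then f i else 0) \<le> (\<Sum>i\<in>J. \<bar>f i\<bar> * p (\<lambda>j. if j = i then 1 else 0))"
    if "finite J" for J
    using that
  proof (induction J)
    case empty
    show ?case using scale[of 0 f] by simp
  next
    case (insert a J)
    have "(\<lambda>i. if i \<in> insert a J then f i else 0) =
        (\<lambda>i. f a * (if i = a then 1 else 0) + (if i \<in> J then f i else 0))"
      using insert by auto
    then have "p (\<lambda>i. if i \<in> insert a J then f i else 0) \<le>
        \<bar>f a\<bar> * p (\<lambda>j. if j = a then 1 else 0) + p (\<lambda>i. if i \<in> J then f i else 0)"
      using add[of "\<lambda>i. f a * (if i = a then 1 else 0)" "\<lambda>i. if i \<in> J then f i else 0"]
      unfolding scale by simp
    then show ?case using insert by simp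
  qed
  from this[OF I] show ?thesis using cong[of f "\<lambda>i. if i \<in> I then f i else 0"] by simp
qed

text \<open>The preceding bound makes \<open>p\<close> continuous for the product topology. As a
  positive function it has a positive minimum on each compact face of the unit cube, and homogeneity
  does the rest.\<close>

lemma norm_ge_coordinates:
  fixes p :: "('a \<Rightarrow> real) \<Rightarrow> real"
  assumes I: "finite I" and cong: "\<And>f g. (\<forall>i\<in>I. f i = g i) \<Longrightarrow> p f = p g"
    and add: "\<And>f g. p (\<lambda>i. f i + g i) \<le> p f + p g"
    and scale: "\<And>c f. p (\<lambda>i. c * f i) = \<bar>c\<bar> * p f"
    and pos: "\<And>f. (\<exists>i\<in>I. f i \<noteq> 0) \<Longrightarrow> 0 < p f"
  shows "\<exists>c>0. \<forall>f. \<forall>i\<in>I. c * \<bar>f i\<bar> \<le> p f"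
proof -
  define \<delta> :: "'a \<Rightarrow> 'a \<Rightarrow> real" where "\<delta> i = (\<lambda>j. if j = i then 1 else 0)" for i
  have upper: "p f \<le> (\<Sum>i\<in>I. \<bar>f i\<bar> * p (\<delta> i))" for f
    unfolding \<delta>_def by (rule seminorm_le_sum_coordinates[of I p, OF I cong add scale])
  have diff: "\<bar>p g - p f\<bar> \<le> (\<Sum>i\<in>I. \<bar>g i - f i\<bar> * p (\<delta> i))" for f g
  proof -
    have "p g \<le> p (\<lambda>i. g i - f i) + p f" "p f \<le> p (\<lambda>i. f i - g i) + p g"
      using add[of "\<lambda>i. g i - f i" f] add[of "\<lambda>i. f i - g i" g] by simp_all
    then show ?thesis using upper[of "\<lambda>i. g i - f i"] upper[of "\<lambda>i. f i - g i"]
      by (simp add: abs_minus_commute)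
  qed
  have "(p \<longlongrightarrow> p f) (at f)" for f
  proof -
    have "continuous_on UNIV (\<lambda>g. \<Sum>i\<in>I. \<bar>g i - f i\<bar> * p (\<delta> i))"
      by (intro continuous_intros continuous_on_product_coordinates)
    then have "((\<lambda>g. \<Sum>i\<in>I. \<bar>g i - f i\<bar> * p (\<delta> i)) \<longlongrightarrow> (\<Sum>i\<in>I. \<bar>f i - f i\<bar> * p (\<delta> i))) (at f)"
      unfolding continuous_on_def by blast
    then have "((\<lambda>g. \<Sum>i\<in>I. \<bar>g i - f i\<bar> * p (\<delta> i)) \<longlongrightarrow> 0) (at f)" by simp
    then have "((\<lambda>g. p g - p f) \<longlongrightarrow> 0) (at f)"
      by (rule tendsto_0_le[where K = 1]) (simp add: order.trans[OF diff abs_ge_self])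
    then show ?thesis by (rule LIM_zero_cancel)
  qed
  then have "continuous_on UNIV p" by (simp add: continuous_on_def)
  then have cont: "continuous_on A p" for A by (rule continuous_on_subset) simp
  \<comment> \<open>The face \<open>f i = 1\<close> of the cube; the value 0 outside
    \<open>I\<close> makes it compact in the whole function space.\<close>
  define A :: "'a \<Rightarrow> ('a \<Rightarrow> real) set"
    where "A i = PiE UNIV (\<lambda>j. if j \<in> I then if j = i then {1} else {-1..1} else {0})" for i
  have "\<exists>c>0. \<forall>f\<in>A i. c \<le> p f" if i: "i \<in> I" for i
  proof -
    have "compactin (product_topology (\<lambda>_. euclidean) UNIV) (A i)"
      unfolding A_def compactin_PiE by simp
    then have "compact (A i)" by (simp add: euclidean_product_topology)
    moreover have "\<delta> i \<in> A i" using i by (auto simp: A_def \<delta>_def)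
    ultimately obtain f where f: "f \<in> A i" "\<forall>g\<in>A i. p f \<le> p g"
      using continuous_attains_inf[OF _ _ cont, of "A i"] by blast
    have "f i = 1" using f(1) i by (auto simp: A_def PiE_iff split: if_splits)
    then have "0 < p f" using i by (intro pos bexI[of _ i]) simp_all
    then show ?thesis using f by blast
  qed
  then have "\<forall>i\<in>I. \<exists>c>0. \<forall>f\<in>A i. c \<le> p f" by blast
  from bchoice[OF this] obtain c where c: "\<forall>i\<in>I. 0 < c i \<and> (\<forall>f\<in>A i. c i \<le> p f)" by (elim exE)
  define d where "d = Min (insert 1 (c ` I))"
  have d: "0 < d" "\<And>i. i \<in> I \<Longrightarrow> d \<le> c i" using c I by (auto simp: d_def)
  have "d * \<bar>f j\<bar> \<le> p f" if j: "j \<in> I" for f j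
  proof (cases "\<exists>i\<in>I. f i \<noteq> 0")
    case False
    then show ?thesis using j cong[of f "\<lambda>i. 0 * f i"] scale[of 0 f] by simp
  next
    case True
    have "Max ((\<lambda>i. \<bar>f i\<bar>) ` I) \<in> (\<lambda>i. \<bar>f i\<bar>) ` I" using I j by (intro Max_in) auto
    then obtain i where i: "i \<in> I" "Max ((\<lambda>i. \<bar>f i\<bar>) ` I) = \<bar>f i\<bar>" by auto
    have le: "\<bar>f k\<bar> \<le> \<bar>f i\<bar>" if "k \<in> I" for k unfolding i(2)[symmetric] using I that by (intro Max_ge) auto
    have fi: "f i \<noteq> 0" using True le by force
    \<comment> \<open>Division by a coordinate of largest absolute value, sign included, lands in
      the face \<open>A i\<close>, so the opposite faces never arise.\<close>
    define g where "g k = (if k \<in> I then f k / f i else 0)" for k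
    have "g \<in> A i"
    proof -
      have "-1 \<le> f k / f i \<and> f k / f i \<le> 1" if "k \<in> I" for k
      proof -
        have "\<bar>f k / f i\<bar> \<le> 1" using le[OF that] fi by (simp add: abs_divide)
        then show ?thesis by linarith
      qed
      then show ?thesis using fi i by (auto simp: A_def g_def)
    qed
    then have "d \<le> p g" using c d(2) i by force
    have "p f = \<bar>f i\<bar> * p g"
      unfolding scale[symmetric] using fi by (intro cong) (auto simp: g_def)
    also have "\<dots> \<ge> \<bar>f i\<bar> * d" using \<open>d \<le> p g\<close> by (intro mult_left_mono) auto
    finally have "d * \<bar>f i\<bar> \<le> p f" by (simp add: mult.commute)
    moreover have "d * \<bar>f j\<bar> \<le> d * \<bar>f i\<bar>" using d le[OF j] by simp
    ultimately show ?thesis by linarith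
  qed
  then show ?thesis using d by blast
qed

text \<open>Matrices are read as functions on index pairs. From here on \<open>N\<close> enters only
  through these two comparisons and its nonnegativity.\<close>

lemma norm_on_mat_equivalent_max_norm:
  assumes N: "norm_on_mat n N"
  shows "\<exists>c>0. \<forall>A\<in>carrier_mat n n. \<forall>i<n. \<forall>j<n. c * \<bar>A $$ (i, j)\<bar> \<le> N A"
    and "\<exists>C\<ge>0. \<forall>A\<in>carrier_mat n n. \<forall>b. (\<forall>i<n. \<forall>j<n. \<bar>A $$ (i, j)\<bar> \<le> b) \<longrightarrow> N A \<le> C * b"
proof -
  define p where "p f = N (mat n n f)" for f
  define I where "I = {..<n} \<times> {..<n}"
  have I: "finite I" by (simp add: I_def)
  have cong: "p f = p g" if "\<forall>i\<in>I. f i = g i" for f g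
    unfolding p_def using that by (intro arg_cong[of _ _ N] eq_matI) (auto simp: I_def)
  have add: "p (\<lambda>i. f i + g i) \<le> p f + p g" for f g
  proof -
    have "mat n n (\<lambda>i. f i + g i) = mat n n f + mat n n g" by (intro eq_matI) auto
    then show ?thesis using N by (simp add: p_def norm_on_mat_def)
  qed
  have scale: "p (\<lambda>i. c * f i) = \<bar>c\<bar> * p f" for c f
  proof -
    have "mat n n (\<lambda>i. c * f i) = c \<cdot>\<^sub>m mat n n f" by (intro eq_matI) auto
    then show ?thesis using N by (simp add: p_def norm_on_mat_def)
  qed
  have pos: "0 < p f" if f: "\<exists>i\<in>I. f i \<noteq> 0" for f
  proof -
    obtain i j where ij: "i < n" "j < n" "f (i, j) \<noteq> 0" using f by (auto simp: I_def)
    have "mat n n f \<noteq> 0\<^sub>m n n"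
    proof
      assume "mat n n f = 0\<^sub>m n n"
      then have "mat n n f $$ (i, j) = 0\<^sub>m n n $$ (i, j)" by simp
      then show False using ij by simp
    qed
    then have "N (mat n n f) \<noteq> 0" "0 \<le> N (mat n n f)" using N by (auto simp: norm_on_mat_def)
    then show ?thesis by (simp add: p_def)
  qed
  have pA: "p (\<lambda>i. A $$ i) = N A" if "A \<in> carrier_mat n n" for A
    unfolding p_def using that by (intro arg_cong[of _ _ N] eq_matI) auto
  obtain c where c: "0 < c" "\<forall>f. \<forall>i\<in>I. c * \<bar>f i\<bar> \<le> p f"
    using norm_ge_coordinates[of I p, OF I cong add scale pos] by blast
  have "c * \<bar>A $$ (i, j)\<bar> \<le> N A" if "A \<in> carrier_mat n n" "i < n" "j < n" for A i j
  proof -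
    have "(i, j) \<in> I" using that by (simp add: I_def)
    then have "c * \<bar>A $$ (i, j)\<bar> \<le> p (\<lambda>i. A $$ i)" using c(2) by blast
    then show ?thesis using pA that by simp
  qed
  then show "\<exists>c>0. \<forall>A\<in>carrier_mat n n. \<forall>i<n. \<forall>j<n. c * \<bar>A $$ (i, j)\<bar> \<le> N A"
    using c(1) by blast
  define C where "C = (\<Sum>i\<in>I. p (\<lambda>j. if j = i then 1 else 0))"
  have p0: "0 \<le> p f" for f using N by (simp add: p_def norm_on_mat_def)
  have "N A \<le> C * b" if A: "A \<in> carrier_mat n n" and b: "\<forall>i<n. \<forall>j<n. \<bar>A $$ (i, j)\<bar> \<le> b" for A b
  proof -
    have "N A \<le> (\<Sum>i\<in>I. \<bar>A $$ i\<bar> * p (\<lambda>j. if j = i then 1 else 0))"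
      unfolding pA[OF A, symmetric] by (rule seminorm_le_sum_coordinates[of I p, OF I cong add scale])
    also have "\<dots> \<le> (\<Sum>i\<in>I. b * p (\<lambda>j. if j = i then 1 else 0))"
      using b p0 by (intro sum_mono mult_right_mono) (auto simp: I_def)
    finally show ?thesis by (simp add: C_def sum_distrib_left sum_distrib_right mult.commute)
  qed
  moreover have "0 \<le> C" using p0 by (simp add: C_def sum_nonneg)
  ultimately show "\<exists>C\<ge>0. \<forall>A\<in>carrier_mat n n. \<forall>b. (\<forall>i<n. \<forall>j<n. \<bar>A $$ (i, j)\<bar> \<le> b) \<longrightarrow> N A \<le> C * b"
    by blast
qed

section \<open>Matrix products and their growth\<close>

text \<open>Pulling the starting value \<open>X\<close> out of the fold allows a factor to be
  appended at the right end of a product.\<close>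

lemma foldr_mult_mat:
  fixes As :: "real mat list"
  assumes "set As \<subseteq> carrier_mat n n" "X \<in> carrier_mat n n"
  shows "foldr (*) As (1\<^sub>m n) \<in> carrier_mat n n \<and> foldr (*) As X = foldr (*) As (1\<^sub>m n) * X"
  using assms by (induction As) (auto simp: assoc_mult_mat[of _ n n _ n _ n])

lemma mat_products_carrier:
  assumes "\<Sigma> \<subseteq> carrier_mat n n"
  shows "mat_products n \<Sigma> k \<subseteq> carrier_mat n n"
  using assms foldr_mult_mat[of _ n "1\<^sub>m n"] by (auto simp: mat_products_def)

lemma finite_mat_products:
  assumes "finite \<Sigma>"
  shows "finite (mat_products n \<Sigma> k)"
proof -
  have "mat_products n \<Sigma> k = (\<lambda>As. foldr (*) As (1\<^sub>m n)) ` {As. set As \<subseteq> \<Sigma> \<and> length As = k}"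
    by (auto simp: mat_products_def)
  then show ?thesis using finite_lists_length_eq[OF assms] by simp
qed

lemma mat_products_nonempty:
  assumes "\<Sigma> \<noteq> {}"
  shows "mat_products n \<Sigma> k \<noteq> {}"
proof -
  obtain A where "A \<in> \<Sigma>" using assms by auto
  then have "foldr (*) (replicate k A) (1\<^sub>m n) \<in> mat_products n \<Sigma> k"
    unfolding mat_products_def by (auto intro!: exI[of _ "replicate k A"] split: if_splits)
  then show ?thesis by auto
qed

lemma mat_products_mult_right:
  assumes "\<Sigma> \<subseteq> carrier_mat n n" "B \<in> mat_products n \<Sigma> k" "A \<in> \<Sigma>"
  shows "B * A \<in> mat_products n \<Sigma> (Suc k)"
proof -
  obtain As where As: "B = foldr (*) As (1\<^sub>m n)" "length As = k" "set As \<subseteq> \<Sigma>"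
    using assms(2) by (auto simp: mat_products_def)
  have "A \<in> carrier_mat n n" "set As \<subseteq> carrier_mat n n" using assms As by auto
  then have "A * 1\<^sub>m n = A" "foldr (*) As A = B * A"
    using foldr_mult_mat[of As n A] As(1) by auto
  then have "foldr (*) (As @ [A]) (1\<^sub>m n) = B * A" by simp
  then show ?thesis using As assms(3) unfolding mat_products_def
    by (intro CollectI exI[of _ "As @ [A]"]) auto
qed

lemma mat_products_growth:
  assumes \<Sigma>: "\<Sigma> \<subseteq> carrier_mat n n" and s: "0 \<le> s"
    and W: "\<And>A x. A \<in> \<Sigma> \<Longrightarrow> x \<in> carrier_vec n \<Longrightarrow> W (A *\<^sub>v x) \<le> s * W x"
    and B: "B \<in> mat_products n \<Sigma> k" and x: "x \<in> carrier_vec n"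
  shows "W (B *\<^sub>v x) \<le> s ^ k * (W x :: real)"
proof -
  have "W (foldr (*) As (1\<^sub>m n) *\<^sub>v x) \<le> s ^ length As * W x" if "set As \<subseteq> \<Sigma>" for As
    using that
  proof (induction As)
    case Nil
    then show ?case using x by simp
  next
    case (Cons A As)
    define P where "P = foldr (*) As (1\<^sub>m n)"
    have P: "P \<in> carrier_mat n n" "A \<in> carrier_mat n n"
      using foldr_mult_mat[of As n "1\<^sub>m n"] Cons.prems \<Sigma> by (auto simp: P_def)
    have "W ((A * P) *\<^sub>v x) = W (A *\<^sub>v (P *\<^sub>v x))" using P x by simp
    also have "\<dots> \<le> s * W (P *\<^sub>v x)" using Cons.prems P x by (intro W) auto
    also have "\<dots> \<le> s * (s ^ length As * W x)"
      using Cons s by (intro mult_left_mono) (auto simp: P_def)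
    finally show ?case by (simp add: P_def mult_ac)
  qed
  then show ?thesis using B by (auto simp: mat_products_def)
qed

text \<open>Measured by \<open>W\<close>, products of length \<open>k\<close> grow at most like
  \<open>s ^ k\<close>, hence \<open>N B \<le> D * s ^ k\<close> with a fixed \<open>D\<close>,
  whose \<open>k\<close>-th root tends to 1. \<open>W\<close> will be a given norm or the sum of
  absolute coordinates.\<close>

lemma joint_spectral_radius_le:
  assumes \<Sigma>: "finite \<Sigma>" "\<Sigma> \<noteq> {}" "\<Sigma> \<subseteq> carrier_mat n n" and N: "norm_on_mat n N"
    and c: "0 < c" "\<And>x i. x \<in> carrier_vec n \<Longrightarrow> i < n \<Longrightarrow> c * \<bar>x $ i\<bar> \<le> W x"
    and s: "0 \<le> s" "\<And>A x. A \<in> \<Sigma> \<Longrightarrow> x \<in> carrier_vec n \<Longrightarrow> W (A *\<^sub>v x) \<le> s * W x"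
  shows "joint_spectral_radius n N \<Sigma> \<le> ereal s"
proof -
  obtain C where C: "C \<ge> 0"
    "\<forall>A\<in>carrier_mat n n. \<forall>b. (\<forall>i<n. \<forall>j<n. \<bar>A $$ (i, j)\<bar> \<le> b) \<longrightarrow> N A \<le> C * b"
    using norm_on_mat_equivalent_max_norm(2)[OF N] by blast
  have W0: "0 \<le> W (unit_vec n j)" if "j < n" for j
  proof -
    have "0 \<le> c * \<bar>unit_vec n j $ j\<bar>" using c by simp
    also have "\<dots> \<le> W (unit_vec n j)" using that by (intro c(2)) auto
    finally show ?thesis .
  qed
  define w where "w = (\<Sum>j<n. W (unit_vec n j))"
  have w: "W (unit_vec n j) \<le> w" if "j < n" for j
    unfolding w_def using that W0 by (intro member_le_sum) auto
  have w0: "0 \<le> w" unfolding w_def using W0 by (intro sum_nonneg) auto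
  \<comment> \<open>The summand 1 keeps \<open>D\<close> positive, so that its roots do tend to
    1.\<close>
  define D where "D = C * w / c + 1"
  have D: "0 < D" using C w0 c by (simp add: D_def add_nonneg_pos)
  have NB: "N B \<le> D * s ^ k" if B: "B \<in> mat_products n \<Sigma> k" for B k
  proof -
    have Bc: "B \<in> carrier_mat n n" using mat_products_carrier[OF \<Sigma>(3)] B by auto
    have "\<bar>B $$ (i, j)\<bar> \<le> s ^ k * w / c" if ij: "i < n" "j < n" for i j
    proof -
      have "B $$ (i, j) = (B *\<^sub>v unit_vec n j) $ i" using Bc ij by simp
      then have "c * \<bar>B $$ (i, j)\<bar> \<le> W (B *\<^sub>v unit_vec n j)"
        using c(2)[of "B *\<^sub>v unit_vec n j" i] Bc ij by simp
      also have "\<dots> \<le> s ^ k * W (unit_vec n j)"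
        by (rule mat_products_growth[OF \<Sigma>(3) s(1) s(2) B]) auto
      also have "\<dots> \<le> s ^ k * w" using w[OF ij(2)] s by (intro mult_left_mono) auto
      finally show ?thesis using c by (simp add: pos_le_divide_eq mult.commute)
    qed
    then have "N B \<le> C * (s ^ k * w / c)" using C(2) Bc by blast
    also have "\<dots> \<le> D * s ^ k" using s by (simp add: D_def algebra_simps)
    finally show ?thesis .
  qed
  have "ereal (Max ((\<lambda>A. root k (N A)) ` mat_products n \<Sigma> k)) \<le> ereal (root k D * s)" if k: "1 \<le> k" for k
  proof -
    have "root k (N B) \<le> root k D * s" if "B \<in> mat_products n \<Sigma> k" for B
    proof -
      have "root k (N B) \<le> root k (D * s ^ k)" using k NB[OF that] by simp
      also have "\<dots> = root k D * s" using k s by (simp add: real_root_mult real_root_power_cancel)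
      finally show ?thesis .
    qed
    then show ?thesis
      using finite_mat_products[OF \<Sigma>(1)] mat_products_nonempty[OF \<Sigma>(2)] by simp
  qed
  then have "joint_spectral_radius n N \<Sigma> \<le> limsup (\<lambda>k. ereal (root k D * s))"
    unfolding joint_spectral_radius_def
    by (intro Limsup_mono) (auto simp: eventually_sequentially intro!: exI[of _ 1])
  also have "\<dots> = ereal s"
  proof (rule lim_imp_Limsup)
    have "(\<lambda>k. root k D * s) \<longlonglongrightarrow> 1 * s" using D by (intro tendsto_intros LIMSEQ_root_const)
    then show "(\<lambda>k. ereal (root k D * s)) \<longlonglongrightarrow> ereal s" by simp
  qed simp
  finally show ?thesis .
qed

lemma joint_spectral_radius_nonneg:
  assumes \<Sigma>: "finite \<Sigma>" "\<Sigma> \<noteq> {}" "\<Sigma> \<subseteq> carrier_mat n n" and N: "norm_on_mat n N"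
  shows "0 \<le> joint_spectral_radius n N \<Sigma>"
proof -
  have "0 \<le> Max ((\<lambda>A. root k (N A)) ` mat_products n \<Sigma> k)" for k
  proof -
    obtain B where B: "B \<in> mat_products n \<Sigma> k" using mat_products_nonempty[OF \<Sigma>(2)] by blast
    then have "0 \<le> N B"
      using N mat_products_carrier[OF \<Sigma>(3)] by (auto simp: norm_on_mat_def)
    then have "0 \<le> root k (N B)" by (cases "k = 0") auto
    also have "\<dots> \<le> Max ((\<lambda>A. root k (N A)) ` mat_products n \<Sigma> k)"
      using B finite_mat_products[OF \<Sigma>(1)] by (intro Max_ge) auto
    finally show ?thesis .
  qed
  then have "limsup (\<lambda>k. 0) \<le> joint_spectral_radius n N \<Sigma>"
    unfolding joint_spectral_radius_def by (intro Limsup_mono) auto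
  then show ?thesis by (simp add: Limsup_const)
qed

text \<open>From some \<open>k0\<close> on, the limsup being below \<open>r\<close> gives
  \<open>N B \<le> r ^ k\<close>; the finitely many shorter lengths are absorbed into the
  constant.\<close>

lemma mat_products_entries_le:
  assumes \<Sigma>: "finite \<Sigma>" "\<Sigma> \<subseteq> carrier_mat n n" and N: "norm_on_mat n N"
    and r: "0 < r" "joint_spectral_radius n N \<Sigma> < ereal r"
  shows "\<exists>C. \<forall>k. \<forall>B\<in>mat_products n \<Sigma> k. \<forall>i<n. \<forall>j<n. \<bar>B $$ (i, j)\<bar> \<le> C * r ^ k"
proof -
  obtain c where c: "0 < c" "\<forall>A\<in>carrier_mat n n. \<forall>i<n. \<forall>j<n. c * \<bar>A $$ (i, j)\<bar> \<le> N A"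
    using norm_on_mat_equivalent_max_norm(1)[OF N] by blast
  have "eventually (\<lambda>k. ereal (Max ((\<lambda>A. root k (N A)) ` mat_products n \<Sigma> k)) < ereal r) sequentially"
    using r(2) unfolding joint_spectral_radius_def by (rule Limsup_lessD)
  then obtain k0 where k0: "\<And>k. k0 \<le> k \<Longrightarrow> Max ((\<lambda>A. root k (N A)) ` mat_products n \<Sigma> k) < r"
    by (auto simp: eventually_sequentially)
  define Bs where "Bs = (\<Union>k\<le>k0. (\<lambda>B. N B / r ^ k) ` mat_products n \<Sigma> k)"
  have finBs: "finite Bs" using finite_mat_products[OF \<Sigma>(1)] by (simp add: Bs_def)
  define M where "M = Max (insert 1 Bs)"
  have NB: "N B \<le> M * r ^ k" if B: "B \<in> mat_products n \<Sigma> k" for k B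
  proof (cases "k \<le> k0")
    case True
    then have "N B / r ^ k \<in> Bs" using B by (auto simp: Bs_def)
    then have "N B / r ^ k \<le> M" unfolding M_def using finBs by (intro Max_ge) auto
    then show ?thesis using r by (simp add: pos_divide_le_eq)
  next
    case False
    have "root k (N B) \<le> Max ((\<lambda>A. root k (N A)) ` mat_products n \<Sigma> k)"
      using B finite_mat_products[OF \<Sigma>(1)] by (intro Max_ge) auto
    also have "\<dots> < r" using k0 False by simp
    finally have lt: "root k (N B) < r" .
    have "0 \<le> N B" using N mat_products_carrier[OF \<Sigma>(2)] B by (auto simp: norm_on_mat_def)
    then have "N B = root k (N B) ^ k" "0 \<le> root k (N B)" using False by auto
    then have "N B \<le> r ^ k" using lt power_mono[of "root k (N B)" r k] by simp
    also have "1 \<le> M" unfolding M_def using finBs by (intro Max_ge) auto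
    then have "r ^ k \<le> M * r ^ k" using r by simp
    finally show ?thesis .
  qed
  have "\<bar>B $$ (i, j)\<bar> \<le> M / c * r ^ k" if B: "B \<in> mat_products n \<Sigma> k" and ij: "i < n" "j < n" for k B i j
  proof -
    have "c * \<bar>B $$ (i, j)\<bar> \<le> N B" using c(2) mat_products_carrier[OF \<Sigma>(2)] B ij by blast
    also have "\<dots> \<le> M * r ^ k" using NB[OF B] .
    finally show ?thesis using c(1) by (simp add: field_simps)
  qed
  then show ?thesis by blast
qed

subsection \<open>Approximation by maxima of linear forms\<close>

definition scaled_rows :: "nat \<Rightarrow> real mat set \<Rightarrow> real \<Rightarrow> real vec set" where
  "scaled_rows n \<Sigma> r = {(1 / r ^ k) \<cdot>\<^sub>v row B i | k B i. B \<in> mat_products n \<Sigma> k \<and> i < n}"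

lemma scaled_rows_carrier:
  assumes "\<Sigma> \<subseteq> carrier_mat n n"
  shows "scaled_rows n \<Sigma> r \<subseteq> carrier_vec n"
  using mat_products_carrier[OF assms] by (fastforce simp: scaled_rows_def)

lemma unit_vec_in_scaled_rows:
  assumes "i < n"
  shows "unit_vec n i \<in> scaled_rows n \<Sigma> r"
proof -
  have "1\<^sub>m n \<in> mat_products n \<Sigma> 0" by (auto simp: mat_products_def)
  moreover have "unit_vec n i = (1 / r ^ 0) \<cdot>\<^sub>v row (1\<^sub>m n) i" using assms by simp
  ultimately show ?thesis using assms unfolding scaled_rows_def by blast
qed

lemma scaled_rows_bounded:
  assumes \<Sigma>: "finite \<Sigma>" "\<Sigma> \<subseteq> carrier_mat n n" and N: "norm_on_mat n N"
    and r: "0 < r" "joint_spectral_radius n N \<Sigma> < ereal r"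
  shows "\<exists>C. \<forall>f\<in>scaled_rows n \<Sigma> r. \<forall>i<n. \<bar>f $ i\<bar> \<le> C"
proof -
  obtain C where C: "\<forall>k. \<forall>B\<in>mat_products n \<Sigma> k. \<forall>i<n. \<forall>j<n. \<bar>B $$ (i, j)\<bar> \<le> C * r ^ k"
    using mat_products_entries_le[OF assms] by blast
  have "\<bar>f $ j\<bar> \<le> C" if f: "f \<in> scaled_rows n \<Sigma> r" and j: "j < n" for f j
  proof -
    obtain k B i where B: "f = (1 / r ^ k) \<cdot>\<^sub>v row B i" "B \<in> mat_products n \<Sigma> k" "i < n"
      using f by (auto simp: scaled_rows_def)
    have "B \<in> carrier_mat n n" using mat_products_carrier[OF \<Sigma>(2)] B by auto
    then have "f $ j = B $$ (i, j) / r ^ k" using B j by simp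
    moreover have "\<bar>B $$ (i, j)\<bar> \<le> C * r ^ k" using C B j by blast
    ultimately show ?thesis using r by (simp add: pos_divide_le_eq)
  qed
  then show ?thesis by blast
qed

lemma scaled_rows_mult:
  assumes \<Sigma>: "\<Sigma> \<subseteq> carrier_mat n n" and r: "0 < r" and A: "A \<in> \<Sigma>"
    and f: "f \<in> scaled_rows n \<Sigma> r" and x: "x \<in> carrier_vec n"
  shows "\<exists>g\<in>scaled_rows n \<Sigma> r. f \<bullet> (A *\<^sub>v x) = r * (g \<bullet> x)"
proof -
  obtain k B i where B: "f = (1 / r ^ k) \<cdot>\<^sub>v row B i" "B \<in> mat_products n \<Sigma> k" "i < n"
    using f by (auto simp: scaled_rows_def)
  have c: "B \<in> carrier_mat n n" "A \<in> carrier_mat n n"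
    using mat_products_carrier[OF \<Sigma>] B A \<Sigma> by auto
  define g where "g = (1 / r ^ Suc k) \<cdot>\<^sub>v row (B * A) i"
  have "g \<in> scaled_rows n \<Sigma> r"
    using mat_products_mult_right[OF \<Sigma> B(2) A] B(3) unfolding g_def scaled_rows_def by blast
  moreover have "row B i \<bullet> (A *\<^sub>v x) = row (B * A) i \<bullet> x"
  proof -
    have "row B i \<bullet> (A *\<^sub>v x) = (B *\<^sub>v (A *\<^sub>v x)) $ i" using c B(3) by simp
    also have "B *\<^sub>v (A *\<^sub>v x) = (B * A) *\<^sub>v x" using c x by simp
    also have "\<dots> $ i = row (B * A) i \<bullet> x" using c B(3) by (subst index_mult_mat_vec) auto
    finally show ?thesis .
  qed
  then have "f \<bullet> (A *\<^sub>v x) = r * (g \<bullet> x)"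
    using c B x r unfolding B(1) g_def
    by (subst (1 2) smult_scalar_prod_distrib[of _ n]) auto
  ultimately show ?thesis by blast
qed

text \<open>Among the norm axioms only definiteness depends on the choice of \<open>S\<close>; the
  lower bound by coordinates supplies it.\<close>

lemma Max_abs_scalar_prod_norm:
  assumes S: "finite S" "S \<noteq> {}" "S \<subseteq> carrier_vec n"
    and c: "0 < c" "\<And>x i. x \<in> carrier_vec n \<Longrightarrow> i < n \<Longrightarrow> c * \<bar>x $ i\<bar> \<le> Max ((\<lambda>g. \<bar>g \<bullet> x\<bar>) ` S)"
  shows "norm_on_vec n (\<lambda>x. Max ((\<lambda>g. \<bar>g \<bullet> x\<bar>) ` S))"
proof -
  have ge: "\<bar>g \<bullet> x\<bar> \<le> Max ((\<lambda>g. \<bar>g \<bullet> x\<bar>) ` S)" if "g \<in> S" for g x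
    using S that by (intro Max_ge) auto
  obtain g0 where g0: "g0 \<in> S" using S by auto
  have nonneg: "0 \<le> Max ((\<lambda>g. \<bar>g \<bullet> x\<bar>) ` S)" for x using ge[OF g0, of x] by linarith
  have eq0: "Max ((\<lambda>g. \<bar>g \<bullet> x\<bar>) ` S) = 0 \<longleftrightarrow> x = 0\<^sub>v n" if x: "x \<in> carrier_vec n" for x
  proof
    assume 0: "Max ((\<lambda>g. \<bar>g \<bullet> x\<bar>) ` S) = 0"
    have "x $ i = 0" if "i < n" for i
      using c(2)[OF x that] c(1) 0 by (simp add: mult_le_0_iff)
    then show "x = 0\<^sub>v n" using x by (intro eq_vecI) auto
  next
    assume "x = 0\<^sub>v n"
    then have "(\<lambda>g. \<bar>g \<bullet> x\<bar>) ` S = (\<lambda>g. 0) ` S" using S by (intro image_cong) auto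
    then show "Max ((\<lambda>g. \<bar>g \<bullet> x\<bar>) ` S) = 0" using S by simp
  qed
  have scale: "Max ((\<lambda>g. \<bar>g \<bullet> (a \<cdot>\<^sub>v x)\<bar>) ` S) = \<bar>a\<bar> * Max ((\<lambda>g. \<bar>g \<bullet> x\<bar>) ` S)"
    if x: "x \<in> carrier_vec n" for x a
  proof -
    have "(\<lambda>g. \<bar>g \<bullet> (a \<cdot>\<^sub>v x)\<bar>) ` S = (\<lambda>g. \<bar>a\<bar> * \<bar>g \<bullet> x\<bar>) ` S"
      using S x by (intro image_cong refl) (auto simp: abs_mult)
    also have "\<dots> = (\<lambda>t. \<bar>a\<bar> * t) ` (\<lambda>g. \<bar>g \<bullet> x\<bar>) ` S" by (simp add: image_image)
    also have "Max \<dots> = \<bar>a\<bar> * Max ((\<lambda>g. \<bar>g \<bullet> x\<bar>) ` S)"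
      using S by (intro mono_Max_commute[symmetric]) (auto simp: mono_def mult_left_mono)
    finally show ?thesis .
  qed
  have "Max ((\<lambda>g. \<bar>g \<bullet> (x + y)\<bar>) ` S) \<le> Max ((\<lambda>g. \<bar>g \<bullet> x\<bar>) ` S) + Max ((\<lambda>g. \<bar>g \<bullet> y\<bar>) ` S)"
    if xy: "x \<in> carrier_vec n" "y \<in> carrier_vec n" for x y
  proof (rule Max.boundedI)
    fix t assume "t \<in> (\<lambda>g. \<bar>g \<bullet> (x + y)\<bar>) ` S"
    then obtain g where g: "g \<in> S" "t = \<bar>g \<bullet> (x + y)\<bar>" by auto
    have "g \<bullet> (x + y) = g \<bullet> x + g \<bullet> y" using S g xy by (intro scalar_prod_add_distrib) auto
    then show "t \<le> Max ((\<lambda>g. \<bar>g \<bullet> x\<bar>) ` S) + Max ((\<lambda>g. \<bar>g \<bullet> y\<bar>) ` S)"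
      using g ge[of g x] ge[of g y] by linarith
  qed (use S in auto)
  with nonneg eq0 scale show ?thesis by (simp add: norm_on_vec_def)
qed

lemma jsr_upper_approx_le:
  assumes \<Sigma>: "finite \<Sigma>" "\<Sigma> \<noteq> {}" "\<Sigma> \<subseteq> carrier_mat n n" and V: "norm_on_vec n V"
    and s: "\<And>A x. A \<in> \<Sigma> \<Longrightarrow> x \<in> carrier_vec n \<Longrightarrow> V (A *\<^sub>v x) \<le> s * V x"
  shows "jsr_upper_approx n \<Sigma> V \<le> ereal s"
proof -
  have "V (A *\<^sub>v x) / V x \<le> s" if "A \<in> \<Sigma>" "x \<in> carrier_vec n - {0\<^sub>v n}" for A x
  proof -
    have "0 < V x" using V that by (force simp: norm_on_vec_def order_le_less)
    then show ?thesis using s[of A x] that by (simp add: pos_divide_le_eq)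
  qed
  then have "(SUP x \<in> carrier_vec n - {0\<^sub>v n}. ereal (V (A *\<^sub>v x) / V x)) \<le> ereal s" if "A \<in> \<Sigma>" for A
    using that by (intro SUP_least) auto
  then show ?thesis using \<Sigma> by (auto simp: jsr_upper_approx_def)
qed

text \<open>A finite value \<open>s\<close> of the upper approximation is a growth factor for
  \<open>V\<close>, to which \<open>joint_spectral_radius_le\<close> applies. A nonzero vector, from
  \<open>1 \<le> n\<close>, shows that \<open>s\<close> is nonnegative.\<close>

lemma jsr_upper_approx_ge:
  assumes n: "1 \<le> n" and \<Sigma>: "finite \<Sigma>" "\<Sigma> \<noteq> {}" "\<Sigma> \<subseteq> carrier_mat n n"
    and N: "norm_on_mat n N" and V: "norm_on_vec n V"
    and c: "0 < c" "\<And>x i. x \<in> carrier_vec n \<Longrightarrow> i < n \<Longrightarrow> c * \<bar>x $ i\<bar> \<le> V x"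
  shows "joint_spectral_radius n N \<Sigma> \<le> jsr_upper_approx n \<Sigma> V"
proof (cases "jsr_upper_approx n \<Sigma> V = \<infinity>")
  case False
  have ge: "ereal (V (A *\<^sub>v x) / V x) \<le> jsr_upper_approx n \<Sigma> V"
    if "A \<in> \<Sigma>" "x \<in> carrier_vec n - {0\<^sub>v n}" for A x
  proof -
    have "ereal (V (A *\<^sub>v x) / V x) \<le> (SUP x \<in> carrier_vec n - {0\<^sub>v n}. ereal (V (A *\<^sub>v x) / V x))"
      using that by (intro SUP_upper) auto
    also have "\<dots> \<le> jsr_upper_approx n \<Sigma> V"
      unfolding jsr_upper_approx_def using \<Sigma> that by (intro Max_ge) auto
    finally show ?thesis .
  qed
  obtain A0 where A0: "A0 \<in> \<Sigma>" using \<Sigma> by auto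
  have Vn: "0 \<le> V x" if "x \<in> carrier_vec n" for x using V that by (simp add: norm_on_vec_def)
  have u0: "unit_vec n 0 \<in> carrier_vec n - {0\<^sub>v n}" using n by simp
  have "A0 *\<^sub>v unit_vec n 0 \<in> carrier_vec n" using A0 \<Sigma> by auto
  then have "0 \<le> V (A0 *\<^sub>v unit_vec n 0) / V (unit_vec n 0)" using Vn by simp
  then have U0: "0 \<le> jsr_upper_approx n \<Sigma> V" using ge[OF A0 u0] by (meson ereal_less_eq(5) order.trans)
  then obtain s where s: "jsr_upper_approx n \<Sigma> V = ereal s" "0 \<le> s"
    using False by (cases "jsr_upper_approx n \<Sigma> V") auto
  have "V (A *\<^sub>v x) \<le> s * V x" if A: "A \<in> \<Sigma>" and x: "x \<in> carrier_vec n" for A x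
  proof (cases "x = 0\<^sub>v n")
    case True
    have "A \<in> carrier_mat n n" using A \<Sigma> by auto
    then have "A *\<^sub>v x = 0\<^sub>v n" using True by (intro eq_vecI) auto
    moreover have "V (0\<^sub>v n) = 0" using V zero_carrier_vec by (auto simp: norm_on_vec_def)
    ultimately show ?thesis using True by simp
  next
    case False
    then have "V (A *\<^sub>v x) / V x \<le> s" using ge[of A x] A x s by simp
    moreover have "V x > 0" using V x False by (force simp: norm_on_vec_def order_le_less)
    ultimately show ?thesis by (simp add: pos_divide_le_eq)
  qed
  then show ?thesis unfolding s using s(2) by (intro joint_spectral_radius_le[OF \<Sigma> N c]) auto
qed simp

text \<open>A crude bound with two uses: the radius is finite, and it is 0 for the zero
  matrix.\<close>

lemma joint_spectral_radius_le_sum_entries: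
  assumes \<Sigma>: "finite \<Sigma>" "\<Sigma> \<noteq> {}" "\<Sigma> \<subseteq> carrier_mat n n" and N: "norm_on_mat n N"
  shows "joint_spectral_radius n N \<Sigma> \<le> ereal (\<Sum>A\<in>\<Sigma>. \<Sum>i<n. \<Sum>j<n. \<bar>A $$ (i, j)\<bar>)"
proof (rule joint_spectral_radius_le[OF \<Sigma> N, where c = 1 and W = "\<lambda>x. \<Sum>i<n. \<bar>x $ i\<bar>"])
  fix A and x :: "real vec" assume A: "A \<in> \<Sigma>" and x: "x \<in> carrier_vec n"
  have Ac: "A \<in> carrier_mat n n" using A \<Sigma> by auto
  have "(\<Sum>i<n. \<bar>(A *\<^sub>v x) $ i\<bar>) \<le> (\<Sum>i<n. \<Sum>j<n. \<bar>A $$ (i, j)\<bar> * (\<Sum>j<n. \<bar>x $ j\<bar>))"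
  proof (rule sum_mono)
    fix i assume i: "i \<in> {..<n}"
    have "\<bar>(A *\<^sub>v x) $ i\<bar> \<le> (\<Sum>j<n. \<bar>A $$ (i, j) * x $ j\<bar>)"
      using Ac x i by (simp add: scalar_prod_def lessThan_atLeast0)
    also have "\<dots> \<le> (\<Sum>j<n. \<bar>A $$ (i, j)\<bar> * (\<Sum>j<n. \<bar>x $ j\<bar>))"
      unfolding abs_mult by (intro sum_mono mult_left_mono member_le_sum) auto
    finally show "\<bar>(A *\<^sub>v x) $ i\<bar> \<le> \<dots>" .
  qed
  also have "\<dots> = (\<Sum>i<n. \<Sum>j<n. \<bar>A $$ (i, j)\<bar>) * (\<Sum>j<n. \<bar>x $ j\<bar>)"
    by (simp add: sum_distrib_right)
  also have "\<dots> \<le> (\<Sum>A\<in>\<Sigma>. \<Sum>i<n. \<Sum>j<n. \<bar>A $$ (i, j)\<bar>) * (\<Sum>j<n. \<bar>x $ j\<bar>)"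
    using A \<Sigma>(1) by (intro mult_right_mono member_le_sum) (auto intro!: sum_nonneg)
  finally show "(\<Sum>i<n. \<bar>(A *\<^sub>v x) $ i\<bar>) \<le> \<dots>" .
qed (auto intro!: sum_nonneg member_le_sum)

lemma approximates_jsr_Max_abs:
  assumes n: "1 \<le> n" and \<Sigma>: "finite \<Sigma>" "\<Sigma> \<noteq> {}" "\<Sigma> \<subseteq> carrier_mat n n"
    and N: "norm_on_mat n N" and pos: "0 < joint_spectral_radius n N \<Sigma> \<or> \<Sigma> = {0\<^sub>m n n}"
    and \<tau>: "1 < \<tau>" and q: "0 < q" "1 / \<tau> < 1 - 2 * real n / real q"
  shows "\<exists>S. finite S \<and> S \<noteq> {} \<and> S \<subseteq> carrier_vec n \<and> card S \<le> (if n = 1 then 1 else q ^ n) \<and>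
    approximates_jsr n N \<Sigma> \<tau> (\<lambda>x. Max ((\<lambda>g. \<bar>g \<bullet> x\<bar>) ` S))"
proof -
  \<comment> \<open>Strictly between what is required and what the grid guarantees;
    \<open>1 / \<tau> < \<kappa>\<close> makes \<open>\<tau> * \<kappa> * \<rho>\<close> exceed a
    positive \<open>\<rho>\<close>.\<close>
  obtain \<kappa> where \<kappa>: "1 / \<tau> < \<kappa>" "\<kappa> < 1 - 2 * real n / real q" using q(2) dense by blast
  have \<kappa>0: "0 < \<kappa>" using \<kappa>(1) \<tau> by (smt (verit) divide_pos_pos)
  have "0 \<le> 2 * real n / real q" by simp
  then have \<kappa>1: "\<kappa> < 1" using \<kappa>(2) by linarith
  have \<tau>\<kappa>: "1 < \<tau> * \<kappa>" using \<kappa>(1) \<tau> by (simp add: divide_less_eq mult.commute)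
  obtain \<rho> where \<rho>: "joint_spectral_radius n N \<Sigma> = ereal \<rho>" "0 \<le> \<rho>"
    using joint_spectral_radius_le_sum_entries[OF \<Sigma> N] joint_spectral_radius_nonneg[OF \<Sigma> N]
    by (cases "joint_spectral_radius n N \<Sigma>") auto
  \<comment> \<open>The norm will have growth factor \<open>r / \<kappa>\<close>, which is exactly
    the admissible \<open>\<tau> * \<rho>\<close>. For the zero matrix this \<open>r\<close> would
    be 0, and any positive value does.\<close>
  define r where "r = (if \<Sigma> = {0\<^sub>m n n} then 1 else \<tau> * \<kappa> * \<rho>)"
  have r: "0 < r" "joint_spectral_radius n N \<Sigma> < ereal r"
  proof -
    have "\<rho> \<le> 0" if "\<Sigma> = {0\<^sub>m n n}"
      using joint_spectral_radius_le_sum_entries[OF \<Sigma> N] \<rho> that by simp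
    moreover have "0 < \<rho>" if "\<Sigma> \<noteq> {0\<^sub>m n n}" using pos \<rho> that by simp
    ultimately show "0 < r" "joint_spectral_radius n N \<Sigma> < ereal r"
      using \<tau>\<kappa> \<rho> mult_strict_right_mono[OF \<tau>\<kappa>, of \<rho>] by (auto simp: r_def)
  qed
  define K where "K = scaled_rows n \<Sigma> r"
  have K: "K \<subseteq> carrier_vec n" unfolding K_def by (rule scaled_rows_carrier[OF \<Sigma>(3)])
  have e: "unit_vec n i \<in> K" if "i < n" for i unfolding K_def by (rule unit_vec_in_scaled_rows[OF that])
  have Kne: "K \<noteq> {}" using e[of 0] n by auto
  obtain C where "\<forall>f\<in>K. \<forall>i<n. \<bar>f $ i\<bar> \<le> C"
    using scaled_rows_bounded[OF \<Sigma>(1,3) N r] unfolding K_def by (elim exE)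
  then have C: "\<bar>f $ i\<bar> \<le> C" if "f \<in> K" "i < n" for f i using that by blast
  have "\<exists>S. finite S \<and> S \<noteq> {} \<and> S \<subseteq> K \<and> card S \<le> (if n = 1 then 1 else q ^ n) \<and>
    (\<forall>x\<in>carrier_vec n. \<forall>f\<in>K. \<kappa> * \<bar>f \<bullet> x\<bar> \<le> Max ((\<lambda>g. \<bar>g \<bullet> x\<bar>) ` S))"
  proof (cases "n = 1")
    case True
    obtain g where "g \<in> K" "\<forall>x\<in>carrier_vec 1. \<forall>f\<in>K. \<kappa> * \<bar>f \<bullet> x\<bar> \<le> \<bar>g \<bullet> x\<bar>"
      using sup_seminorm_net_dim_1[of K C \<kappa>] K e[of 0] C \<kappa>0 \<kappa>1 True by auto
    then show ?thesis using True by (intro exI[of _ "{g}"]) simp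
  next
    case False
    then show ?thesis
      using sup_seminorm_grid_net[of K n C q \<kappa>, OF K Kne e C q(1) less_imp_le[OF \<kappa>0] \<kappa>(2)] by simp
  qed
  then obtain S where S: "finite S" "S \<noteq> {}" "S \<subseteq> K" "card S \<le> (if n = 1 then 1 else q ^ n)"
    and net: "\<forall>x\<in>carrier_vec n. \<forall>f\<in>K. \<kappa> * \<bar>f \<bullet> x\<bar> \<le> Max ((\<lambda>g. \<bar>g \<bullet> x\<bar>) ` S)" by (elim exE conjE)
  define V where "V = (\<lambda>x. Max ((\<lambda>g. \<bar>g \<bullet> x\<bar>) ` S))"
  have Sc: "S \<subseteq> carrier_vec n" using S(3) K by auto
  have lower: "\<kappa> * \<bar>x $ i\<bar> \<le> V x" if "x \<in> carrier_vec n" "i < n" for x i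
    using net[rule_format, OF that(1) e[OF that(2)]] that by (simp add: V_def)
  have V: "norm_on_vec n V"
    using Max_abs_scalar_prod_norm[OF S(1,2) Sc \<kappa>0] lower unfolding V_def by blast
  have contract: "V (A *\<^sub>v x) \<le> r / \<kappa> * V x" if A: "A \<in> \<Sigma>" and x: "x \<in> carrier_vec n" for A x
    unfolding V_def[THEN fun_cong, of "A *\<^sub>v x"]
  proof (rule Max.boundedI)
    fix t assume "t \<in> (\<lambda>g. \<bar>g \<bullet> (A *\<^sub>v x)\<bar>) ` S"
    then obtain g where g: "g \<in> S" "t = \<bar>g \<bullet> (A *\<^sub>v x)\<bar>" by auto
    \<comment> \<open>\<open>f\<close> lies in \<open>K\<close> but possibly not in
      \<open>S\<close>; returning to \<open>S\<close> costs the factor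
      \<open>1 / \<kappa>\<close>.\<close>
    obtain f where f: "f \<in> K" "g \<bullet> (A *\<^sub>v x) = r * (f \<bullet> x)"
      using scaled_rows_mult[OF \<Sigma>(3) r(1) A _ x, of g] g S(3) unfolding K_def by blast
    have "\<kappa> * \<bar>f \<bullet> x\<bar> \<le> V x" using net f(1) x by (simp add: V_def)
    then have "r * (\<kappa> * \<bar>f \<bullet> x\<bar>) \<le> r * V x" using r by simp
    then show "t \<le> r / \<kappa> * V x" using \<kappa>0 r f g by (simp add: abs_mult field_simps)
  qed (use S in auto)
  have "ereal (1 / \<tau>) * jsr_upper_approx n \<Sigma> V \<le> joint_spectral_radius n N \<Sigma>"
  proof (cases "\<Sigma> = {0\<^sub>m n n}")
    case True
    have "V (A *\<^sub>v x) \<le> 0 * V x" if A: "A \<in> \<Sigma>" and x: "x \<in> carrier_vec n" for A x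
    proof -
      have "A *\<^sub>v x = 0\<^sub>v n" using A x True by (intro eq_vecI) auto
      moreover have "V (0\<^sub>v n) = 0" using V zero_carrier_vec by (auto simp: norm_on_vec_def)
      ultimately show ?thesis by simp
    qed
    from jsr_upper_approx_le[OF \<Sigma> V this] have "jsr_upper_approx n \<Sigma> V \<le> 0" by (simp add: zero_ereal_def)
    then have "ereal (1 / \<tau>) * jsr_upper_approx n \<Sigma> V \<le> ereal (1 / \<tau>) * 0"
      using \<tau> by (intro ereal_mult_left_mono) auto
    then show ?thesis using \<rho> by (simp add: order.trans[of _ 0])
  next
    case False
    have "jsr_upper_approx n \<Sigma> V \<le> ereal (r / \<kappa>)" by (rule jsr_upper_approx_le[OF \<Sigma> V contract])
    then have "ereal (1 / \<tau>) * jsr_upper_approx n \<Sigma> V \<le> ereal (1 / \<tau>) * ereal (r / \<kappa>)"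
      using \<tau> by (intro ereal_mult_left_mono) auto
    also have "\<dots> = joint_spectral_radius n N \<Sigma>" using False \<tau> \<kappa>0 \<rho> by (simp add: r_def)
    finally show ?thesis .
  qed
  moreover have "joint_spectral_radius n N \<Sigma> \<le> jsr_upper_approx n \<Sigma> V"
    by (rule jsr_upper_approx_ge[OF n \<Sigma> N V \<kappa>0 lower])
  ultimately have "approximates_jsr n N \<Sigma> \<tau> V" using V by (simp add: approximates_jsr_def)
  then show ?thesis using S Sc unfolding V_def by blast
qed

section \<open>Maxima of linear forms as CPWL functions\<close>

lemma cpwl_Max_scalar_prod:
  assumes T: "finite T" "T \<noteq> {}" "T \<subseteq> carrier_vec n"
  shows "cpwl n (\<lambda>x. Max ((\<lambda>t. t \<bullet> x) ` T))"
proof -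
  let ?X = "product_topology (\<lambda>_. euclideanreal) {..<n}"
  have "continuous_map ?X euclideanreal (\<lambda>x. t \<bullet> vec n x)" for t
  proof -
    have "(\<lambda>x. t \<bullet> vec n x) = (\<lambda>x. \<Sum>i<n. t $ i * x i)"
      by (simp add: scalar_prod_def lessThan_atLeast0)
    then show ?thesis
      by (auto intro!: continuous_map_sum continuous_map_real_mult continuous_map_product_projection)
  qed
  with T(1,2) have "continuous_map ?X euclideanreal (\<lambda>x. Max ((\<lambda>t. t \<bullet> vec n x) ` T))"
  proof (induction T rule: finite_ne_induct)
    case (insert t T)
    then have "(\<lambda>x. Max ((\<lambda>t. t \<bullet> vec n x) ` insert t T)) =
        (\<lambda>x. max (t \<bullet> vec n x) (Max ((\<lambda>t. t \<bullet> vec n x) ` T)))" by auto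
    then show ?case using insert by (auto intro!: continuous_map_real_max)
  qed simp
  \<comment> \<open>The region where \<open>t\<close> attains the maximum, written with right-hand
    side 0 to match the half-spaces of \<open>polyhedron_vec\<close>.\<close>
  moreover define P where "P t = {x \<in> carrier_vec n. \<forall>s\<in>T. (s - t) \<bullet> x \<le> 0}" for t
  have P: "P t = {x \<in> carrier_vec n. \<forall>s\<in>T. s \<bullet> x \<le> t \<bullet> x}" if "t \<in> T" for t
    using T(3) that unfolding P_def by (auto simp: minus_scalar_prod_distrib[of _ n] subset_iff)
  have "polyhedron_vec n (P t)" if "t \<in> T" for t
    unfolding polyhedron_vec_def P_def
    using T that by (intro exI[of _ "(\<lambda>s. (s - t, 0)) ` T"]) (auto intro!: minus_carrier_vec)
  moreover have "\<Union>(P ` T) = carrier_vec n"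
  proof
    show "carrier_vec n \<subseteq> \<Union>(P ` T)"
    proof
      fix x :: "real vec" assume x: "x \<in> carrier_vec n"
      have "Max ((\<lambda>t. t \<bullet> x) ` T) \<in> (\<lambda>t. t \<bullet> x) ` T" using T by (intro Max_in) auto
      then obtain t where t: "t \<in> T" "Max ((\<lambda>t. t \<bullet> x) ` T) = t \<bullet> x" by auto
      have "s \<bullet> x \<le> t \<bullet> x" if "s \<in> T" for s unfolding t(2)[symmetric] using T that by (intro Max_ge) auto
      then have "x \<in> P t" using P t x by simp
      then show "x \<in> \<Union>(P ` T)" using t by auto
    qed
  qed (auto simp: P_def)
  moreover have "\<exists>a\<in>carrier_vec n. \<forall>x\<in>P t. Max ((\<lambda>t. t \<bullet> x) ` T) = a \<bullet> x" if "t \<in> T" for t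
  proof (intro bexI ballI)
    fix x assume "x \<in> P t"
    then show "Max ((\<lambda>t. t \<bullet> x) ` T) = t \<bullet> x" using P[OF that] T that by (intro Max_eqI) auto
  qed (use T that in auto)
  ultimately show ?thesis unfolding cpwl_def using T(1) by (intro conjI exI[of _ "P ` T"]) auto
qed

text \<open>Trades absolute values for at most twice as many forms, since the networks evaluate
  plain maxima.\<close>

lemma Max_abs_scalar_prod_symmetrize:
  fixes S :: "real vec set"
  assumes S: "finite S" "S \<noteq> {}" "S \<subseteq> carrier_vec n" and x: "x \<in> carrier_vec n"
  shows "Max ((\<lambda>g. \<bar>g \<bullet> x\<bar>) ` S) = Max ((\<lambda>t. t \<bullet> x) ` (S \<union> uminus ` S))"
proof (rule antisym)
  have neg: "(- g) \<bullet> x = - (g \<bullet> x)" if "g \<in> S" for g using that S x by auto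
  show "Max ((\<lambda>g. \<bar>g \<bullet> x\<bar>) ` S) \<le> Max ((\<lambda>t. t \<bullet> x) ` (S \<union> uminus ` S))"
  proof (rule Max.boundedI)
    fix t assume "t \<in> (\<lambda>g. \<bar>g \<bullet> x\<bar>) ` S"
    then obtain g where g: "g \<in> S" "t = \<bar>g \<bullet> x\<bar>" by auto
    have "g \<bullet> x \<le> Max ((\<lambda>t. t \<bullet> x) ` (S \<union> uminus ` S))"
      "(- g) \<bullet> x \<le> Max ((\<lambda>t. t \<bullet> x) ` (S \<union> uminus ` S))"
      using S g by (auto intro!: Max_ge)
    then show "t \<le> Max ((\<lambda>t. t \<bullet> x) ` (S \<union> uminus ` S))" using g neg[OF g(1)] by linarith
  qed (use S in auto)
  show "Max ((\<lambda>t. t \<bullet> x) ` (S \<union> uminus ` S)) \<le> Max ((\<lambda>g. \<bar>g \<bullet> x\<bar>) ` S)"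
  proof (rule Max.boundedI)
    fix t assume "t \<in> (\<lambda>t. t \<bullet> x) ` (S \<union> uminus ` S)"
    then obtain g where g: "g \<in> S" "t = g \<bullet> x \<or> t = - (g \<bullet> x)" using neg by auto
    have "\<bar>g \<bullet> x\<bar> \<le> Max ((\<lambda>g. \<bar>g \<bullet> x\<bar>) ` S)" using S g by (intro Max_ge) auto
    then show "t \<le> Max ((\<lambda>g. \<bar>g \<bullet> x\<bar>) ` S)" using g by linarith
  qed (use S in auto)
qed

lemma cpwl_cong:
  assumes "cpwl n f" and eq: "\<And>x. x \<in> carrier_vec n \<Longrightarrow> g x = f x"
  shows "cpwl n g"
proof -
  have "(\<lambda>x. g (vec n x)) = (\<lambda>x. f (vec n x))" using eq by auto
  moreover obtain \<P> where \<P>: "finite \<P>" "\<forall>P\<in>\<P>. polyhedron_vec n P" "\<Union>\<P> = carrier_vec n"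
    "\<forall>P\<in>\<P>. \<exists>a\<in>carrier_vec n. \<forall>x\<in>P. f x = a \<bullet> x"
    using assms(1) unfolding cpwl_def by (elim exE conjE)
  have "\<forall>P\<in>\<P>. \<exists>a\<in>carrier_vec n. \<forall>x\<in>P. g x = a \<bullet> x"
  proof
    fix P assume P: "P \<in> \<P>"
    then obtain a where "a \<in> carrier_vec n" "\<forall>x\<in>P. f x = a \<bullet> x" using \<P>(4) by blast
    moreover have "P \<subseteq> carrier_vec n" using P \<P>(3) by blast
    ultimately show "\<exists>a\<in>carrier_vec n. \<forall>x\<in>P. g x = a \<bullet> x" using eq by (intro bexI[of _ a]) auto
  qed
  ultimately show ?thesis using assms(1) \<P> unfolding cpwl_def by auto
qed

subsection \<open>Counting\<close>

text \<open>Pascal's rule in a double induction. Such a bilinear bound is strong enough because the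
  exponent in the width supplies all further growth.\<close>

lemma binomial_add_ge_mult: "a * b + 1 \<le> (a + b) choose b"
proof (induction a arbitrary: b)
  case (Suc a)
  show ?case
  proof (induction b)
    case (Suc b)
    have "(Suc a + Suc b) choose Suc b = ((Suc a + b) choose b) + ((a + Suc b) choose Suc b)" by simp
    moreover have "Suc a * b + 1 \<le> (Suc a + b) choose b" by (rule Suc.IH)
    moreover have "a * Suc b + 1 \<le> (a + Suc b) choose Suc b" by (rule \<open>\<And>b. a * b + 1 \<le> (a + b) choose b\<close>)
    ultimately show ?case by (simp add: algebra_simps)
  qed simp
qed simp

text \<open>The summand \<open>m = 0\<close> alone grows at least linearly in \<open>k\<close> once
  \<open>n \<ge> 2\<close>.\<close>

lemma D_num_ge:
  assumes "1 \<le> n"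
  shows "(n - 1) * k + 1 \<le> D_num n k"
proof -
  have "(n - 1) * k + 1 \<le> (n - 1 + k) choose k" by (rule binomial_add_ge_mult)
  also have "\<dots> = (n + k - 1 - 2 * 0) choose (k - 2 * 0)" using assms by simp
  also have "\<dots> \<le> D_num n k" unfolding D_num_def by (rule member_le_sum) auto
  finally show ?thesis .
qed

text \<open>The first binomial coefficient already exceeds \<open>8 * D - n \<ge> 7 * D\<close>,
  since its complementary lower index is \<open>n div 2 \<ge> 1\<close>.\<close>

lemma facet_bound_ge:
  assumes n: "2 \<le> n" and D: "n \<le> D"
  shows "7 * D \<le> facet_bound n (8 * D)"
proof -
  have "8 * D - (n + 1) div 2 = n div 2 + (8 * D - n)" using D n by linarith
  then have "n div 2 * (8 * D - n) + 1 \<le> facet_bound n (8 * D)"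
    using binomial_add_ge_mult[of "n div 2" "8 * D - n"] by (simp add: facet_bound_def)
  moreover have "1 * (8 * D - n) \<le> n div 2 * (8 * D - n)" using n by (intro mult_right_mono) auto
  ultimately show ?thesis using D by linarith
qed

lemma facet_bound_dim_1: "1 \<le> N \<Longrightarrow> facet_bound 1 N = 2"
  by (simp add: facet_bound_def)

text \<open>
  With \<open>\<tau> = cosh \<theta>\<close> the left-hand side of the hypothesis is \<open>2 * cosh (k * \<theta>)\<close>, so \<open>\<theta>\<close> is at
  least of order \<open>1 / k\<close> and \<open>\<tau> - 1\<close> at least of order \<open>1 / k\<^sup>2\<close>.
\<close>

lemma precision_gap:
  fixes \<tau> :: real
  assumes \<tau>: "1 < \<tau>" and k: "1 \<le> k"
    and ge: "6 \<le> (\<tau> - sqrt (\<tau>\<^sup>2 - 1)) ^ k + (\<tau> + sqrt (\<tau>\<^sup>2 - 1)) ^ k"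
  shows "1 / (4 * (real k)\<^sup>2) \<le> \<tau> - 1"
proof (rule ccontr)
  assume "\<not> ?thesis"
  then have lt: "\<tau> - 1 < 1 / (4 * (real k)\<^sup>2)" by simp
  \<comment> \<open>\<open>e\<^sup>2\<close> is the gap in question. Below it,
    \<open>\<tau> + s\<close> is at most \<open>1 + e / 2 + 3 / 2 * e = 1 + 1 / k\<close>, whose
    \<open>k\<close>-th power is at most 3, while \<open>(\<tau> - s) ^ k \<le> 1\<close>: together
    less than 6.\<close>
  define e where "e = 1 / (2 * real k)"
  define s where "s = sqrt (\<tau>\<^sup>2 - 1)"
  have e: "0 < e" "e \<le> 1 / 2" "e\<^sup>2 = 1 / (4 * (real k)\<^sup>2)"
    using k by (auto simp: e_def power_divide power_mult_distrib)
  have lt': "\<tau> - 1 < e\<^sup>2" using lt e by simp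
  have e2: "e\<^sup>2 \<le> e / 2" using e mult_left_mono[OF e(2), of e] by (simp add: power2_eq_square)
  have "\<tau>\<^sup>2 > 1" using \<tau> by (simp add: one_less_power)
  then have s: "0 \<le> s" "s\<^sup>2 = \<tau>\<^sup>2 - 1" by (auto simp: s_def)
  have "\<tau>\<^sup>2 - 1 = (\<tau> - 1) * (\<tau> + 1)" by (simp add: power2_eq_square algebra_simps)
  also have "\<dots> \<le> e\<^sup>2 * (9 / 4)" using lt' \<tau> e e2 by (intro mult_mono) auto
  also have "\<dots> = (3 / 2 * e)\<^sup>2" by (simp add: power2_eq_square)
  finally have "s\<^sup>2 \<le> (3 / 2 * e)\<^sup>2" using s by simp
  then have "s \<le> 3 / 2 * e" by (rule power2_le_imp_le) (use e in auto)
  then have "\<tau> + s \<le> 1 + 1 / real k" using lt' e2 by (simp add: e_def)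
  also have "\<dots> \<le> exp (1 / real k)" by (rule exp_ge_add_one_self)
  finally have "(\<tau> + s) ^ k \<le> exp (1 / real k) ^ k" using \<tau> s by (intro power_mono) auto
  also have "\<dots> = exp 1" using k by (simp flip: exp_of_nat_mult)
  also have "\<dots> \<le> 3" by (rule exp_le)
  finally have up: "(\<tau> + s) ^ k \<le> 3" .
  have prod: "(\<tau> - s) * (\<tau> + s) = 1" using s by (simp add: algebra_simps power2_eq_square)
  have "0 \<le> \<tau> - s" using prod \<tau> s by (smt (verit) mult_nonpos_nonneg)
  moreover have "\<tau> - s \<le> 1" using prod mult_left_mono[of 1 "\<tau> + s" "\<tau> - s"] \<tau> s calculation by simp
  ultimately have "(\<tau> - s) ^ k \<le> 1" by (rule power_le_one)
  then show False using up ge by (simp add: s_def)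
qed

text \<open>Origin of the grid size: with \<open>K = 4 * k\<^sup>2\<close> the gap gives
  \<open>1 / \<tau> \<le> 1 - 1 / (K + 1)\<close>, so the size must exceed
  \<open>2 * n * (K + 1) = n * (8 * k\<^sup>2 + 2)\<close>; the final \<open>+ 1\<close> makes this
  strict.\<close>

lemma grid_size_sufficient:
  fixes \<tau> :: real
  assumes \<tau>: "1 < \<tau>" and k: "1 \<le> k" and gap: "1 / (4 * (real k)\<^sup>2) \<le> \<tau> - 1"
  shows "1 / \<tau> < 1 - 2 * real n / real (n * (8 * k\<^sup>2 + 2) + 1)"
proof -
  define K where "K = 4 * (real k)\<^sup>2"
  have K: "0 < K" using k by (simp add: K_def)
  have "1 / \<tau> \<le> 1 / (1 + 1 / K)" using gap K \<tau> by (intro divide_left_mono) (auto simp: K_def add_pos_pos)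
  also have "\<dots> = 1 - 1 / (K + 1)" using K by (simp add: field_simps)
  also have "\<dots> < 1 - 2 * real n / real (n * (8 * k\<^sup>2 + 2) + 1)"
  proof -
    define Q where "Q = real (n * (8 * k\<^sup>2 + 2) + 1)"
    have "Q = 2 * real n * (K + 1) + 1" by (simp add: Q_def K_def algebra_simps)
    moreover have "0 < Q" unfolding Q_def of_nat_0_less_iff by simp
    ultimately have "2 * real n / Q < 1 / (K + 1)" using K by (simp add: field_simps)
    then show ?thesis by (simp add: Q_def)
  qed
  finally show ?thesis .
qed

text \<open>The exponent is \<open>(2 * n + 1) * (n + 1)\<close>. With
  \<open>q \<le> F\<^sup>2\<close> the \<open>q ^ n\<close> grid cells cost
  \<open>F ^ (2 * n)\<close>, one more factor \<open>F \<ge> 6 * n\<close> pays for the constants,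
  and the power \<open>n + 1\<close> comes from counting small subsets.\<close>

lemma width_budget:
  assumes n: "2 \<le> n" and k: "1 \<le> k" and F: "7 * ((n - 1) * k + 1) \<le> F"
  shows "3 * (2 * (n * (8 * k\<^sup>2 + 2) + 1) ^ n) ^ (n + 1) * n \<le> F ^ (2 * n\<^sup>2 + 3 * n + 1)"
proof -
  define q where "q = n * (8 * k\<^sup>2 + 2) + 1"
  obtain a where a: "n = a + 2" using n by (metis add.commute le_Suc_ex)
  obtain j where j: "k = j + 1" using k by (metis add.commute le_Suc_ex)
  have "q \<le> (7 * ((n - 1) * k + 1))\<^sup>2"
    by (simp add: q_def a j power2_eq_square algebra_simps)
  also have "\<dots> \<le> F\<^sup>2" using F by (rule power_mono) simp
  finally have q: "q \<le> F\<^sup>2" .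
  have "6 * n \<le> 7 * ((n - 1) * k + 1)" by (simp add: a j algebra_simps)
  then have nF: "6 * n \<le> F" using F by (rule order.trans)
  have "3 * (2 * q ^ n) ^ (n + 1) * n = (3 * n) ^ 1 * (2 * q ^ n) ^ (n + 1)" by simp
  \<comment> \<open>The lone factor \<open>3 * n\<close> is raised to the power \<open>n + 1\<close>
    so that it merges with the doubling into \<open>6 * n\<close>.\<close>
  also have "\<dots> \<le> (3 * n) ^ (n + 1) * (2 * q ^ n) ^ (n + 1)"
    using n by (intro mult_right_mono power_increasing) auto
  also have "\<dots> = (6 * n * q ^ n) ^ (n + 1)"
  proof -
    have "6 * n * q ^ n = 3 * n * (2 * q ^ n)" by simp
    then show ?thesis by (simp only: power_mult_distrib)
  qed
  also have "\<dots> \<le> (F * (F\<^sup>2) ^ n) ^ (n + 1)"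
    using nF q by (intro power_mono mult_mono) auto
  also have "\<dots> = F ^ ((1 + 2 * n) * (n + 1))"
  proof -
    have "F * (F\<^sup>2) ^ n = F ^ (1 + 2 * n)" by (simp add: power_mult)
    then show ?thesis by (simp only: power_mult)
  qed
  also have "(1 + 2 * n) * (n + 1) = 2 * n\<^sup>2 + 3 * n + 1"
    by (simp add: power2_eq_square algebra_simps)
  finally show ?thesis unfolding q_def .
qed

theorem theorem8:
  "\<exists>C > 0. \<forall>(n::nat) \<Sigma> N (\<tau>::real) (k::nat).
     1 \<le> n \<longrightarrow>
     finite \<Sigma> \<longrightarrow> \<Sigma> \<noteq> {} \<longrightarrow> \<Sigma> \<subseteq> carrier_mat n n \<longrightarrow>
     norm_on_mat n N \<longrightarrow>
     0 < joint_spectral_radius n N \<Sigma> \<or> \<Sigma> = {0\<^sub>m n n} \<longrightarrow>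
     1 < \<tau> \<longrightarrow> 1 \<le> k \<longrightarrow>
     (\<tau> - sqrt (\<tau>\<^sup>2 - 1)) ^ k + (\<tau> + sqrt (\<tau>\<^sup>2 - 1)) ^ k \<ge> 6 * sqrt (real (D_num n k)) \<longrightarrow>
     (\<exists>V net.
        cpwl n V \<and>
        represents n net V \<and>
        relu_net_depth net = nat \<lceil>log 2 (real n + 1)\<rceil> + 1 \<and>
        real (relu_net_width net)
          \<le> C * real (facet_bound n (vertex_bound n k)) ^ (2 * n\<^sup>2 + 3 * n + 1) \<and>
        approximates_jsr n N \<Sigma> \<tau> V)"
proof (intro exI[of _ "1 :: real"] conjI allI impI)
  fix n :: nat and \<Sigma> :: "real mat set" and N :: "real mat \<Rightarrow> real" and \<tau> :: real and k :: nat
  assume n: "1 \<le> n" and \<Sigma>: "finite \<Sigma>" "\<Sigma> \<noteq> {}" "\<Sigma> \<subseteq> carrier_mat n n" and N: "norm_on_mat n N"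
    and pos: "0 < joint_spectral_radius n N \<Sigma> \<or> \<Sigma> = {0\<^sub>m n n}" and \<tau>: "1 < \<tau>" and k: "1 \<le> k"
    and hyp: "(\<tau> - sqrt (\<tau>\<^sup>2 - 1)) ^ k + (\<tau> + sqrt (\<tau>\<^sup>2 - 1)) ^ k \<ge> 6 * sqrt (real (D_num n k))"
  have D: "(n - 1) * k + 1 \<le> D_num n k" by (rule D_num_ge[OF n])
  then have "1 \<le> D_num n k" by linarith
  \<comment> \<open>Since \<open>D_num n k\<close> is at least 1, the hypothesis yields the bound 6
    that \<open>precision_gap\<close> expects.\<close>
  then have "1 \<le> sqrt (real (D_num n k))" by simp
  then have "1 / (4 * (real k)\<^sup>2) \<le> \<tau> - 1" using hyp by (intro precision_gap[OF \<tau> k]) linarith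
  from grid_size_sufficient[OF \<tau> k this, of n]
  obtain S where S: "finite S" "S \<noteq> {}" "S \<subseteq> carrier_vec n"
    and card: "card S \<le> (if n = 1 then 1 else (n * (8 * k\<^sup>2 + 2) + 1) ^ n)"
    and approx: "approximates_jsr n N \<Sigma> \<tau> (\<lambda>x. Max ((\<lambda>g. \<bar>g \<bullet> x\<bar>) ` S))"
    using approximates_jsr_Max_abs[OF n \<Sigma> N pos \<tau>, of "n * (8 * k\<^sup>2 + 2) + 1"] by auto
  define V where "V = (\<lambda>x. Max ((\<lambda>g. \<bar>g \<bullet> x\<bar>) ` S))"
  define T where "T = S \<union> uminus ` S"
  have T: "finite T" "T \<noteq> {}" "T \<subseteq> carrier_vec n" using S by (auto simp: T_def)
  have VT: "V x = Max ((\<lambda>t. t \<bullet> x) ` T)" if "x \<in> carrier_vec n" for x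
    unfolding V_def T_def by (rule Max_abs_scalar_prod_symmetrize[OF S that])
  have "cpwl n (\<lambda>x. Max ((\<lambda>t. t \<bullet> x) ` T))" by (rule cpwl_Max_scalar_prod[OF T])
  then have cpwl: "cpwl n V" using VT by (rule cpwl_cong)
  obtain net where net: "represents n net (\<lambda>x. Max ((\<lambda>t. t \<bullet> x) ` T))"
    "relu_net_depth net = nat \<lceil>log 2 (real n + 1)\<rceil> + 1"
    "relu_net_width net \<le> 3 * card T ^ (n + 1) * n"
    using Max_scalar_prod_relu_net[OF n T(1,3,2)] by (elim exE conjE)
  have rep: "represents n net V" using net(1) VT by (simp add: represents_def)
  have "card T \<le> card S + card (uminus ` S)" unfolding T_def by (rule card_Un_le)
  also have "\<dots> \<le> 2 * card S" using card_image_le[OF S(1), of uminus] by simp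
  finally have cardT: "card T \<le> 2 * card S" .
  have "3 * card T ^ (n + 1) * n \<le> facet_bound n (vertex_bound n k) ^ (2 * n\<^sup>2 + 3 * n + 1)"
  proof (cases "n = 1")
    case True
    \<comment> \<open>One form and its negative: the width is at most
      \<open>3 * 2\<^sup>2 = 12\<close>, against a budget of \<open>2 ^ 6\<close>.\<close>
    have "1 \<le> vertex_bound n k" using \<open>1 \<le> D_num n k\<close> by (simp add: vertex_bound_def)
    then have "facet_bound n (vertex_bound n k) = 2" using True facet_bound_dim_1 by simp
    moreover have "card T ^ 2 \<le> 2 ^ 2" using card cardT True by (intro power_mono) auto
    ultimately show ?thesis using True by (simp add: power2_eq_square)
  next
    case False
    then have n2: "2 \<le> n" using n by simp
    have "(n - 1) * 1 \<le> (n - 1) * k" using k by (intro mult_le_mono2)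
    then have "n \<le> D_num n k" using D by linarith
    then have "7 * D_num n k \<le> facet_bound n (vertex_bound n k)"
      unfolding vertex_bound_def by (rule facet_bound_ge[OF n2])
    then have F: "7 * ((n - 1) * k + 1) \<le> facet_bound n (vertex_bound n k)"
      using mult_le_mono2[OF D, of 7] by (rule order.trans[rotated])
    have "card T \<le> 2 * (n * (8 * k\<^sup>2 + 2) + 1) ^ n" using card cardT False by simp
    then have "3 * card T ^ (n + 1) * n \<le> 3 * (2 * (n * (8 * k\<^sup>2 + 2) + 1) ^ n) ^ (n + 1) * n"
      by (intro mult_right_mono mult_left_mono power_mono) auto
    also have "\<dots> \<le> facet_bound n (vertex_bound n k) ^ (2 * n\<^sup>2 + 3 * n + 1)"
      by (rule width_budget[OF n2 k F])
    finally show ?thesis .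
  qed
  with net(3) have "relu_net_width net \<le> facet_bound n (vertex_bound n k) ^ (2 * n\<^sup>2 + 3 * n + 1)"
    by (rule order.trans)
  then have "real (relu_net_width net) \<le> real (facet_bound n (vertex_bound n k) ^ (2 * n\<^sup>2 + 3 * n + 1))"
    by (simp only: of_nat_le_iff)
  then have "real (relu_net_width net)
      \<le> 1 * real (facet_bound n (vertex_bound n k)) ^ (2 * n\<^sup>2 + 3 * n + 1)" by simp
  then show "\<exists>V net. cpwl n V \<and> represents n net V \<and>
      relu_net_depth net = nat \<lceil>log 2 (real n + 1)\<rceil> + 1 \<and>
      real (relu_net_width net)
        \<le> 1 * real (facet_bound n (vertex_bound n k)) ^ (2 * n\<^sup>2 + 3 * n + 1) \<and>
      approximates_jsr n N \<Sigma> \<tau> V"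
    using cpwl rep net(2) approx unfolding V_def by blast
qed simp

end
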